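(* Let $n\ge 1$ and $k\ge 0$ be integers such that $\mathscr{G}_n^k$ is nonempty. Among all connected graphs with $n$ vertices and exactly $k$ cut edges, the last graph in the $S$-order is uniquely $K_n^k$; that is, $K_n^k\in\mathscr{G}_n^k$ and $G\prec_s K_n^k$ for every $G\in\mathscr{G}_n^k$ not isomorphic to $K_n^k$.
   Context: All graphs are finite, simple, undirected and connected. A cut edge of a connected graph is an edge whose deletion breaks the graph into two components. $\mathscr{G}_n^k$ is the set of all connected $n$-vertex graphs with exactly $k$ cut edges (graphs are considered up to isomorphism). For an $n$-vertex graph $G$ with adjacency eigenvalues $\lambda_1(G)\ge\dots\ge\lambda_n(G)$, the $i$th spectral moment is $S_i(G)=\sum_{j=1}^n\lambda_j(G)^i$ for $i=0,1,\dots,n-1$. For two $n$-vertex graphs $G_1,G_2$, write $G_1\prec_s G_2$ ($G_1$ comes before $G_2$ in the $S$-order) if for some $j\in\{1,\dots,n-1\}$ we have $S_i(G_1)=S_i(G_2)$ for $i=0,1,\dots,j-1$ and $S_j(G_1)<S_j(G_2)$. $K_m$ is the complete graph on $m$ vertices. $K_n^k$ is the $n$-vertex graph obtained by attaching $k$ pendant vertices to one vertex of $K_{n-k}$ (so $K_n^0=K_n$ and $K_n^{n-1}$ is the star $K_{1,n-1}$).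
   Formalization: The comparison claim is stated only for (n,k) ≠ (4,3): there the path P_4 and the star K_{1,3} have equal spectral moments S_0,…,S_3, so neither precedes the other in the S-order and the claim as printed fails. *)

theory Defs
  imports
    "Graph_Theory.Graph_Theory"
    "Jordan_Normal_Form.Char_Poly"
begin

text \<open>
  A finite simple undirected graph is a \<open>pair_graph\<close> of the AFP entry \<open>Graph_Theory\<close>, that is, a
  finite loop-free symmetric digraph without parallel arcs: an edge \<open>uv\<close> is represented by
  the two arcs \<open>(u,v)\<close> and \<open>(v,u)\<close>, and below it is identified with the set \<open>{u,v}\<close>.
\<close>

definition edges :: "'a pair_pre_digraph \<Rightarrow> 'a set set" where
  "edges G = {{u, v} |u v. (u, v) \<in> parcs G}"

definition delete_edge :: "'a pair_pre_digraph \<Rightarrow> 'a set \<Rightarrow> 'a pair_pre_digraph" where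
  "delete_edge G e = G\<lparr>parcs := {(u, v) \<in> parcs G. {u, v} \<noteq> e}\<rparr>"

text \<open>For symmetric digraphs the strongly connected components are the connected components.\<close>

definition cut_edges :: "'a pair_pre_digraph \<Rightarrow> 'a set set" where
  "cut_edges G = {e \<in> edges G. card (pre_digraph.sccs (with_proj (delete_edge G e))) = 2}"

definition graphs_with_cut_edges :: "nat \<Rightarrow> nat \<Rightarrow> 'a pair_pre_digraph set" where
  "graphs_with_cut_edges n k = {G. pair_graph G \<and> Digraph_Component.connected (with_proj G) \<and>
     card (pverts G) = n \<and> card (cut_edges G) = k}"

text \<open>
  The rows and columns of the adjacency matrix are indexed by an arbitrary enumeration of the
  vertices; a different enumeration gives a similar matrix, hence the same eigenvalues.
\<close>

definition vertex_list :: "'a pair_pre_digraph \<Rightarrow> 'a list" where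
  "vertex_list G = (SOME vs. distinct vs \<and> set vs = pverts G)"

definition adjacency_matrix :: "'a pair_pre_digraph \<Rightarrow> real mat" where
  "adjacency_matrix G = mat (card (pverts G)) (card (pverts G))
     (\<lambda>(i, j). if (vertex_list G ! i, vertex_list G ! j) \<in> parcs G then 1 else 0)"

text \<open>
  The eigenvalues, with algebraic multiplicity. As the adjacency matrix is real symmetric, its
  characteristic polynomial splits over the reals, so no eigenvalue is lost.
\<close>

definition adjacency_eigenvalues :: "'a pair_pre_digraph \<Rightarrow> real multiset" where
  "adjacency_eigenvalues G = proots (char_poly (adjacency_matrix G))"

definition spectral_moment :: "nat \<Rightarrow> 'a pair_pre_digraph \<Rightarrow> real" where
  "spectral_moment i G = (\<Sum>x\<in>#adjacency_eigenvalues G. x ^ i)"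

text \<open>
  Only the moments of order at most \<open>n - 1\<close> are compared. Since the star and the path on four
  vertices first differ in their fourth moments, neither of them precedes the other.
\<close>

definition S_less :: "'a pair_pre_digraph \<Rightarrow> 'b pair_pre_digraph \<Rightarrow> bool" (infix \<open>\<prec>\<^sub>s\<close> 50) where
  "G1 \<prec>\<^sub>s G2 \<longleftrightarrow> card (pverts G1) = card (pverts G2) \<and>
     (\<exists>j\<in>{1..card (pverts G1) - 1}.
        (\<forall>i<j. spectral_moment i G1 = spectral_moment i G2) \<and>
        spectral_moment j G1 < spectral_moment j G2)"

text \<open>
  \<open>K_pendant n k\<close> is $K_n^k$ (meaningful for \<open>k < n\<close>): the vertices \<open>0, \<dots>, n - k - 1\<close>
  form the clique, and \<open>n - k, \<dots>, n - 1\<close> are the pendant vertices, all attached to \<open>0\<close>.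
\<close>

definition K_pendant :: "nat \<Rightarrow> nat \<Rightarrow> nat pair_pre_digraph" where
  "K_pendant n k = \<lparr>pverts = {0..<n},
     parcs = {(u, v). u < n - k \<and> v < n - k \<and> u \<noteq> v}
       \<union> {0} \<times> {n - k..<n} \<union> {n - k..<n} \<times> {0}\<rparr>"

end

theory Submission
  imports Defs "Jordan_Normal_Form.Schur_Decomposition"
begin

text \<open>
  Write \<open>q = n - k\<close>. Deleting the \<open>k\<close> cut edges leaves \<open>k + 1\<close> classes of mutually connected
  vertices, and all other edges run inside classes. A sum of squares of class sizes is largest when
  one class has all the \<open>q - 1\<close> surplus vertices, so the number of edges, half the second moment, is at
  most \<open>q (q - 1) / 2 + k\<close>, with equality only if the graph is a clique on \<open>q\<close> vertices to which trees
  are attached. Among those graphs the third moments agree, as all triangles lie in the clique. So do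
  the numbers of 4-cycles, hence the fourth moment is governed by the sum of the squared degrees. The
  degrees exceed a fixed lower bound by a total which depends on \<open>n\<close> and \<open>k\<close> only, and the sum of
  squares is largest precisely when a single clique vertex takes the whole excess.
\<close>

subsection \<open>Power sums of the eigenvalues of a real symmetric matrix\<close>

text \<open>Moments become traces of powers, hence counts of closed walks, because a symmetric real
  matrix has only real eigenvalues. Arcs are counted, so every edge counts twice. The baseline for
  the degrees is \<open>q - 1\<close> on the clique and 1 elsewhere, with excess \<open>k\<close>.
  Trees (\<open>q = 1\<close>) are treated apart: beyond one vertex, connectedness raises the
  baseline to 1 everywhere, the excess is \<open>k - 1\<close>, and the one-vertex clique is not
  determined by the graph. The case \<open>q = 2\<close> never arises: the edge inside a class of
  two vertices would be a bridge itself. The obstacle is the range of the order: moments beyond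
  \<open>n - 1\<close> are ignored, so the fourth one can decide only for \<open>n \<ge> 5\<close>.
  An excess spread over several vertices is at least 2, which gives \<open>n \<ge> 5\<close> if
  \<open>q \<ge> 3\<close>, and \<open>k \<ge> 3\<close> if \<open>q = 1\<close>. Only the pair (4,
  3) is left over, where star and path share all compared moments.\<close>

definition mat_trace :: "'a::comm_monoid_add mat \<Rightarrow> 'a" where
  "mat_trace A = (\<Sum>i<dim_row A. A $$ (i, i))"

lemma mat_trace_mult_comm:
  fixes A B :: "'a::comm_semiring_0 mat"
  assumes "A \<in> carrier_mat n m" "B \<in> carrier_mat m n"
  shows "mat_trace (A * B) = mat_trace (B * A)"
proof -
  have "mat_trace (A * B) = (\<Sum>i<n. \<Sum>j<m. A $$ (i, j) * B $$ (j, i))"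
    using assms by (auto simp: mat_trace_def scalar_prod_def atLeast0LessThan intro!: sum.cong)
  also have "\<dots> = (\<Sum>j<m. \<Sum>i<n. B $$ (j, i) * A $$ (i, j))"
    by (subst sum.swap) (simp add: mult.commute)
  also have "\<dots> = mat_trace (B * A)"
    using assms by (auto simp: mat_trace_def scalar_prod_def atLeast0LessThan intro!: sum.cong)
  finally show ?thesis .
qed

lemma mat_trace_similar:
  fixes A B :: "'a::comm_semiring_1 mat"
  assumes "similar_mat_wit A B P Q"
  shows "mat_trace A = mat_trace B"
proof -
  define n where "n = dim_row A"
  note w = similar_mat_witD[OF n_def assms]
  have "mat_trace A = mat_trace (P * (B * Q))"
    using w by (metis assoc_mult_mat)
  also have "\<dots> = mat_trace ((B * Q) * P)"
    using w by (intro mat_trace_mult_comm[of _ n n]) auto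
  also have "(B * Q) * P = B * (Q * P)"
    using w by (metis assoc_mult_mat)
  finally show ?thesis
    using w by simp
qed

lemma upper_triangular_pow:
  fixes B :: "'a::comm_semiring_1 mat"
  assumes B: "B \<in> carrier_mat n n" and ut: "upper_triangular B"
  shows "upper_triangular (B ^\<^sub>m k) \<and> (\<forall>i<n. (B ^\<^sub>m k) $$ (i, i) = (B $$ (i, i)) ^ k)"
proof (induction k)
  case 0
  show ?case using B by auto
next
  case (Suc k)
  let ?C = "B ^\<^sub>m k"
  have C: "?C \<in> carrier_mat n n" using B by simp
  have entry: "(?C * B) $$ (i, j) = (\<Sum>l<n. ?C $$ (i, l) * B $$ (l, j))" if "i < n" "j < n" for i j
    using that B C by (simp add: scalar_prod_def atLeast0LessThan)
  have zC: "?C $$ (i, l) = 0" if "l < i" "i < n" for i l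
    using that Suc C by auto
  have zB: "B $$ (i, l) = 0" if "l < i" "i < n" for i l
    using that ut B by auto
  have "(?C * B) $$ (i, j) = 0" if "j < i" "i < n" for i j
  proof -
    have "?C $$ (i, l) * B $$ (l, j) = 0" if "l < n" for l
      using zC[of l i] zB[of j l] that \<open>j < i\<close> \<open>i < n\<close> by (cases "l < i") auto
    then show ?thesis using that by (subst entry) auto
  qed
  moreover have "(?C * B) $$ (i, i) = (B $$ (i, i)) ^ Suc k" if "i < n" for i
  proof -
    have "?C $$ (i, l) * B $$ (l, i) = 0" if "l < n" "l \<noteq> i" for l
      using zC[of l i] zB[of i l] that \<open>i < n\<close> by (cases "l < i") auto
    then have "(\<Sum>l<n. ?C $$ (i, l) * B $$ (l, i)) = ?C $$ (i, i) * B $$ (i, i)"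
      using that by (subst sum.remove[of _ i]) auto
    then show ?thesis using that Suc entry by (simp add: mult.commute)
  qed
  ultimately show ?case using B C by auto
qed

text \<open>Schur decomposition gives a similar triangular matrix with diagonal \<open>es\<close>.
  Its powers carry the powers of \<open>es\<close> on the diagonal, and similarity preserves the
  trace.\<close>

lemma mat_trace_pow_eq_sum_list:
  fixes A :: "'a::conjugatable_ordered_field mat"
  assumes A: "A \<in> carrier_mat n n" and es: "char_poly A = (\<Prod>e\<leftarrow>es. [:- e, 1:])"
  shows "mat_trace (A ^\<^sub>m k) = (\<Sum>e\<leftarrow>es. e ^ k)"
proof -
  obtain B P Q where BPQ: "schur_decomposition A es = (B, P, Q)"
    by (cases "schur_decomposition A es")
  from schur_decomposition[OF A es BPQ]
  have sim: "similar_mat_wit A B P Q" and ut: "upper_triangular B" and diag: "diag_mat B = es"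
    by auto
  have B: "B \<in> carrier_mat n n" using similar_mat_witD2[OF A sim] by simp
  have "mat_trace (A ^\<^sub>m k) = mat_trace (B ^\<^sub>m k)"
    by (rule mat_trace_similar[OF similar_mat_wit_pow[OF sim]])
  also have "\<dots> = (\<Sum>i<n. (B $$ (i, i)) ^ k)"
    using upper_triangular_pow[OF B ut, of k] B by (simp add: mat_trace_def)
  also have "\<dots> = (\<Sum>e\<leftarrow>diag_mat B. e ^ k)"
    using B by (simp add: diag_mat_def comp_def interv_sum_list_conv_sum_set_nat atLeast0LessThan)
  finally show ?thesis by (simp add: diag)
qed

text \<open>The Hermitian form of \<open>A\<close> at an eigenvector is \<open>z\<close> times the
  squared norm, which is positive, and the form equals its own conjugate.\<close>

lemma symmetric_mat_complex_eigenvalue_real: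
  fixes A :: "real mat"
  assumes A: "A \<in> carrier_mat n n" and sym: "transpose_mat A = A"
    and ev: "eigenvalue (map_mat complex_of_real A) z"
  shows "z \<in> \<real>"
proof -
  let ?A = "map_mat complex_of_real A"
  obtain v where v: "v \<in> carrier_vec n" "v \<noteq> 0\<^sub>v n" "?A *\<^sub>v v = z \<cdot>\<^sub>v v"
    using ev A unfolding eigenvalue_def eigenvector_def by auto
  have cA: "?A \<in> carrier_mat n n" using A by simp
  have aij: "A $$ (i, j) = A $$ (j, i)" if "i < n" "j < n" for i j
    using sym that A by (metis carrier_matD index_transpose_mat(1))
  have row: "(\<Sum>j<n. of_real (A $$ (i, j)) * v $ j) = z * v $ i" if "i < n" for i
  proof -
    have "(?A *\<^sub>v v) $ i = (\<Sum>j<n. of_real (A $$ (i, j)) * v $ j)"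
      using that A v(1) by (auto simp: scalar_prod_def atLeast0LessThan intro!: sum.cong)
    then show ?thesis using v(1,3) that by simp
  qed
  define N where "N = (\<Sum>i<n. (cmod (v $ i))\<^sup>2)"
  define S where "S = (\<Sum>i<n. \<Sum>j<n. of_real (A $$ (i, j)) * v $ j * cnj (v $ i))"
  have "S = (\<Sum>i<n. (z * v $ i) * cnj (v $ i))"
    unfolding S_def by (simp add: sum_distrib_right[symmetric] row)
  also have "\<dots> = z * of_real N"
    unfolding N_def by (simp add: sum_distrib_left mult.assoc complex_norm_square del: of_real_power)
  finally have 1: "S = z * of_real N" .
  have "cnj S = (\<Sum>i<n. \<Sum>j<n. of_real (A $$ (i, j)) * v $ i * cnj (v $ j))"
    unfolding S_def by (simp add: ac_simps)
  also have "\<dots> = (\<Sum>j<n. \<Sum>i<n. of_real (A $$ (i, j)) * v $ i * cnj (v $ j))"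
    by (rule sum.swap)
  also have "\<dots> = S"
    unfolding S_def using aij by (intro sum.cong) auto
  finally have 2: "cnj S = S" .
  obtain i where i: "i < n" "v $ i \<noteq> 0"
    using v(1,2) by (metis carrier_vecD eq_vecI index_zero_vec)
  have "N > 0"
    unfolding N_def using i by (intro sum_pos2[of _ i]) auto
  moreover have "cnj z * of_real N = z * of_real N"
    using 1 2 by (metis complex_cnj_complex_of_real complex_cnj_mult)
  ultimately have "cnj z = z" by simp
  then show ?thesis by (simp add: Reals_cnj_iff)
qed

text \<open>Over the reals \<open>proots\<close> sees only real roots, so the trace formula needs a
  full real factorisation. The complex one has real roots and descends along the injective map
  \<open>of_real\<close>.\<close>

lemma symmetric_mat_char_poly_splits:
  fixes A :: "real mat"
  assumes A: "A \<in> carrier_mat n n" and sym: "transpose_mat A = A"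
  obtains es where "char_poly A = (\<Prod>e\<leftarrow>es. [:- e, 1:])"
proof -
  let ?A = "map_mat complex_of_real A"
  interpret h: map_poly_inj_comm_ring_hom complex_of_real ..
  have cA: "?A \<in> carrier_mat n n" using A by simp
  obtain zs where zs: "char_poly ?A = (\<Prod>z\<leftarrow>zs. [:- z, 1:])"
    using char_poly_factorized[OF cA] by blast
  have real: "of_real (Re z) = z" if "z \<in> set zs" for z
  proof -
    have "poly (char_poly ?A) z = 0"
      using that unfolding zs by (induction zs) auto
    then have "eigenvalue ?A z" using eigenvalue_root_char_poly[OF cA] by simp
    then show ?thesis using symmetric_mat_complex_eigenvalue_real[OF A sym] by simp
  qed
  have "map_poly complex_of_real (\<Prod>e\<leftarrow>map Re zs. [:- e, 1:]) = (\<Prod>z\<leftarrow>zs. [:- z, 1:])"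
    using real by (induction zs) (simp_all add: h.hom_mult del: mult_pCons_left)
  then have "map_poly complex_of_real (\<Prod>e\<leftarrow>map Re zs. [:- e, 1:]) = map_poly complex_of_real (char_poly A)"
    using zs of_real_hom.char_poly_hom[OF A] by metis
  then have "char_poly A = (\<Prod>e\<leftarrow>map Re zs. [:- e, 1:])"
    by (simp add: h.injectivity)
  then show ?thesis by (rule that)
qed

lemma proots_prod_list_linear:
  fixes es :: "'a::idom list"
  shows "proots (\<Prod>e\<leftarrow>es. [:- e, 1:]) = mset es"
proof (induction es)
  case (Cons a es)
  have "(\<Prod>e\<leftarrow>es. [:- e, 1:]) \<noteq> 0"
    by (auto simp: prod_list_zero_iff)
  then show ?case
    using Cons by (simp add: proots_mult del: mult_pCons_left)
qed simp

lemma sum_mset_proots_char_poly_power: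
  fixes A :: "real mat"
  assumes A: "A \<in> carrier_mat n n" and sym: "transpose_mat A = A"
  shows "(\<Sum>x\<in>#proots (char_poly A). x ^ k) = mat_trace (A ^\<^sub>m k)"
proof -
  obtain es where es: "char_poly A = (\<Prod>e\<leftarrow>es. [:- e, 1:])"
    using symmetric_mat_char_poly_splits[OF A sym] .
  then show ?thesis
    using mat_trace_pow_eq_sum_list[OF A es, of k]
    by (simp only: proots_prod_list_linear es) (metis mset_map sum_mset_sum_list)
qed

subsection \<open>Spectral moments and closed walks\<close>

text \<open>The recursion of matrix powers with vertices as indices, so that the arbitrary order
  chosen by \<open>vertex_list\<close> disappears from the moments.\<close>

primrec walk_count :: "'a set \<Rightarrow> 'a rel \<Rightarrow> nat \<Rightarrow> 'a \<Rightarrow> 'a \<Rightarrow> nat" where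
  "walk_count V E 0 u v = of_bool (u = v)"
| "walk_count V E (Suc k) u v = (\<Sum>w\<in>V. walk_count V E k u w * of_bool ((w, v) \<in> E))"

lemma vertex_list:
  assumes "finite (pverts G)"
  shows "distinct (vertex_list G)" "set (vertex_list G) = pverts G"
    "length (vertex_list G) = card (pverts G)"
proof -
  have "\<exists>vs. distinct vs \<and> set vs = pverts G"
    using finite_distinct_list[OF assms] by blast
  then show 1: "distinct (vertex_list G)" "set (vertex_list G) = pverts G"
    unfolding vertex_list_def by (metis (mono_tags, lifting) someI_ex)+
  then show "length (vertex_list G) = card (pverts G)"
    by (metis distinct_card)
qed

lemma sum_vertex_list_nth:
  assumes "finite (pverts G)"
  shows "(\<Sum>i<card (pverts G). f (vertex_list G ! i)) = sum f (pverts G)"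
proof -
  have "bij_betw (\<lambda>i. vertex_list G ! i) {..<card (pverts G)} (pverts G)"
    using vertex_list[OF assms] by (metis bij_betw_nth)
  then show ?thesis by (rule sum.reindex_bij_betw)
qed

lemma adjacency_matrix_carrier:
  "adjacency_matrix G \<in> carrier_mat (card (pverts G)) (card (pverts G))"
  by (simp add: adjacency_matrix_def)

lemma adjacency_matrix_pow_index:
  assumes fin: "finite (pverts G)" and "i < card (pverts G)" "j < card (pverts G)"
  shows "(adjacency_matrix G ^\<^sub>m k) $$ (i, j) =
    real (walk_count (pverts G) (parcs G) k (vertex_list G ! i) (vertex_list G ! j))"
  using assms(2,3)
proof (induction k arbitrary: j)
  case 0
  then show ?case
    using vertex_list[OF fin] by (simp add: adjacency_matrix_def nth_eq_iff_index_eq)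
next
  case (Suc k)
  let ?A = "adjacency_matrix G" and ?n = "card (pverts G)" and ?v = "\<lambda>i. vertex_list G ! i"
  let ?w = "walk_count (pverts G) (parcs G)"
  have "(?A ^\<^sub>m k * ?A) $$ (i, j) = (\<Sum>l<?n. (?A ^\<^sub>m k) $$ (i, l) * ?A $$ (l, j))"
    using Suc.prems adjacency_matrix_carrier[of G] pow_carrier_mat[OF adjacency_matrix_carrier, of G k]
    by (simp add: scalar_prod_def atLeast0LessThan)
  also have "\<dots> = (\<Sum>l<?n. real (?w k (?v i) (?v l)) * of_bool ((?v l, ?v j) \<in> parcs G))"
    using Suc by (intro sum.cong) (auto simp: adjacency_matrix_def)
  also have "\<dots> = (\<Sum>w\<in>pverts G. real (?w k (?v i) w) * of_bool ((w, ?v j) \<in> parcs G))"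
    by (rule sum_vertex_list_nth[OF fin])
  finally show ?case by simp
qed

lemma spectral_moment_eq_closed_walks:
  assumes G: "pair_graph G"
  shows "spectral_moment k G = real (\<Sum>v\<in>pverts G. walk_count (pverts G) (parcs G) k v v)"
proof -
  interpret pair_graph G by (fact G)
  let ?A = "adjacency_matrix G" and ?n = "card (pverts G)"
  have fin: "finite (pverts G)" by (rule pair_finite_verts)
  have "(u, v) \<in> parcs G \<longleftrightarrow> (v, u) \<in> parcs G" for u v
    using pair_sym_arcs by (auto simp: symmetric_def elim: symE)
  then have "transpose_mat ?A = ?A"
    by (intro eq_matI) (auto simp: adjacency_matrix_def)
  then have "spectral_moment k G = mat_trace (?A ^\<^sub>m k)"
    unfolding spectral_moment_def adjacency_eigenvalues_def
    by (rule sum_mset_proots_char_poly_power[OF adjacency_matrix_carrier])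
  also have "\<dots> = (\<Sum>i<?n. (?A ^\<^sub>m k) $$ (i, i))"
    using adjacency_matrix_carrier[of G] by (simp add: mat_trace_def)
  also have "\<dots> = (\<Sum>i<?n. real (walk_count (pverts G) (parcs G) k (vertex_list G ! i) (vertex_list G ! i)))"
    by (intro sum.cong adjacency_matrix_pow_index fin) auto
  also have "\<dots> = (\<Sum>v\<in>pverts G. real (walk_count (pverts G) (parcs G) k v v))"
    by (rule sum_vertex_list_nth[OF fin])
  finally show ?thesis by simp
qed

section \<open>Closed walks of length at most four\<close>

locale finite_graph =
  fixes V :: "'a set" and E :: "'a rel"
  assumes finV: "finite V"
    and subset: "E \<subseteq> V \<times> V"
    and symE: "sym E"
    and irreflE: "irrefl E"
begin

lemma finE: "finite E"
  using finV subset by (meson finite_SigmaI finite_subset)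

lemma arcsD: "(u, v) \<in> E \<Longrightarrow> u \<in> V \<and> v \<in> V \<and> u \<noteq> v \<and> (v, u) \<in> E"
  using subset irreflE by (auto simp: irrefl_def intro: symD[OF symE])

definition deg :: "'a \<Rightarrow> nat" where
  "deg v = card {w. (v, w) \<in> E}"

text \<open>Closed walks are rooted and directed: a triangle contributes 6 triples here, and a
  4-cycle contributes 8 quadruples to \<open>cycles4\<close>.\<close>

definition closed3 :: "('a \<times> 'a \<times> 'a) set" where
  "closed3 = {(a, b, c). (a, b) \<in> E \<and> (b, c) \<in> E \<and> (c, a) \<in> E}"

definition closed4 :: "('a \<times> 'a \<times> 'a \<times> 'a) set" where
  "closed4 = {(a, b, c, d). (a, b) \<in> E \<and> (b, c) \<in> E \<and> (c, d) \<in> E \<and> (d, a) \<in> E}"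

definition cycles4 :: "('a \<times> 'a \<times> 'a \<times> 'a) set" where
  "cycles4 = {(a, b, c, d) \<in> closed4. a \<noteq> c \<and> b \<noteq> d}"

lemma sum_walk_count_1: "(\<Sum>v\<in>V. walk_count V E 1 v v) = 0"
  using arcsD by (auto simp: of_bool_def sum.neutral)

lemma card_eq_sum_of_bool:
  "finite A \<Longrightarrow> card {x \<in> A. P x} = (\<Sum>x\<in>A. of_bool (P x))"
  by (simp add: of_bool_def sum.If_cases Int_def)

lemma walk_count_Suc_0:
  assumes "u \<in> V"
  shows "walk_count V E (Suc 0) u v = of_bool ((u, v) \<in> E)"
proof -
  have "walk_count V E (Suc 0) u v =
    of_bool ((u, v) \<in> E) + (\<Sum>w\<in>V - {u}. of_bool (u = w) * of_bool ((w, v) \<in> E))"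
    using assms finV by (simp add: sum.remove)
  also have "(\<Sum>w\<in>V - {u}. of_bool (u = w) * of_bool ((w, v) \<in> E)) = (0::nat)"
    by (rule sum.neutral) auto
  finally show ?thesis by simp
qed

lemma walk_count_Suc_Suc:
  "walk_count V E (Suc (Suc k)) u v = (\<Sum>w\<in>V. walk_count V E (Suc k) u w * of_bool ((w, v) \<in> E))"
  by (rule walk_count.simps)

lemma sum_walk_count_2: "(\<Sum>v\<in>V. walk_count V E 2 v v) = card E"
proof -
  have "(\<Sum>v\<in>V. walk_count V E 2 v v) = (\<Sum>u\<in>V. \<Sum>v\<in>V. of_bool ((u, v) \<in> E))"
    unfolding eval_nat_numeral
    by (intro sum.cong refl) (auto simp: walk_count_Suc_Suc walk_count_Suc_0 of_bool_def simp del: walk_count.simps dest: arcsD intro!: sum.cong)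
  also have "\<dots> = (\<Sum>p\<in>V \<times> V. of_bool (p \<in> E))"
    by (simp add: sum.cartesian_product split_def)
  also have "\<dots> = card {p \<in> V \<times> V. p \<in> E}"
    using finV by (subst card_eq_sum_of_bool) auto
  also have "{p \<in> V \<times> V. p \<in> E} = E"
    using subset by auto
  finally show ?thesis .
qed

lemma sum_walk_count_3: "(\<Sum>v\<in>V. walk_count V E 3 v v) = card closed3"
proof -
  have "(\<Sum>v\<in>V. walk_count V E 3 v v) =
    (\<Sum>a\<in>V. \<Sum>c\<in>V. \<Sum>b\<in>V. of_bool ((a, b) \<in> E \<and> (b, c) \<in> E \<and> (c, a) \<in> E))"
    unfolding eval_nat_numeral
    by (intro sum.cong refl)
      (auto simp: walk_count_Suc_Suc walk_count_Suc_0 sum_distrib_right of_bool_def simp del: walk_count.simps intro!: sum.cong)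
  also have "\<dots> = (\<Sum>(a, c, b)\<in>V \<times> V \<times> V. of_bool ((a, b) \<in> E \<and> (b, c) \<in> E \<and> (c, a) \<in> E))"
    by (simp add: sum.cartesian_product split_def)
  also have "\<dots> = card {x \<in> V \<times> V \<times> V. case x of (a, c, b) \<Rightarrow> (a, b) \<in> E \<and> (b, c) \<in> E \<and> (c, a) \<in> E}"
    using finV by (subst card_eq_sum_of_bool) (auto simp: split_def)
  also have "\<dots> = card closed3"
    by (intro bij_betw_same_card[of "\<lambda>(a, c, b). (a, b, c)"] bij_betw_byWitness[where f' = "\<lambda>(a, b, c). (a, c, b)"])
      (auto simp: closed3_def dest: arcsD)
  finally show ?thesis .
qed

lemma numeral_4_eq_Suc: "4 = Suc (Suc (Suc (Suc 0)))"
  by simp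

lemma sum_walk_count_4: "(\<Sum>v\<in>V. walk_count V E 4 v v) = card closed4"
proof -
  have "(\<Sum>v\<in>V. walk_count V E 4 v v) =
    (\<Sum>a\<in>V. \<Sum>d\<in>V. \<Sum>c\<in>V. \<Sum>b\<in>V. of_bool ((a, b) \<in> E \<and> (b, c) \<in> E \<and> (c, d) \<in> E \<and> (d, a) \<in> E))"
    unfolding numeral_4_eq_Suc
    by (intro sum.cong refl)
      (auto simp: walk_count_Suc_Suc walk_count_Suc_0 sum_distrib_right of_bool_def simp del: walk_count.simps intro!: sum.cong)
  also have "\<dots> = (\<Sum>(a, d, c, b)\<in>V \<times> V \<times> V \<times> V. of_bool ((a, b) \<in> E \<and> (b, c) \<in> E \<and> (c, d) \<in> E \<and> (d, a) \<in> E))"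
    by (simp add: sum.cartesian_product split_def)
  also have "\<dots> = card {x \<in> V \<times> V \<times> V \<times> V. case x of (a, d, c, b) \<Rightarrow> (a, b) \<in> E \<and> (b, c) \<in> E \<and> (c, d) \<in> E \<and> (d, a) \<in> E}"
    using finV by (subst card_eq_sum_of_bool) (auto simp: split_def)
  also have "\<dots> = card closed4"
    by (intro bij_betw_same_card[of "\<lambda>(a, d, c, b). (a, b, c, d)"] bij_betw_byWitness[where f' = "\<lambda>(a, b, c, d). (a, d, c, b)"])
      (auto simp: closed4_def dest: arcsD)
  finally show ?thesis .
qed

lemma sum_deg: "(\<Sum>v\<in>V. deg v) = card E"
proof -
  have "card (SIGMA v:V. {w. (v, w) \<in> E}) = (\<Sum>v\<in>V. deg v)"
    unfolding deg_def using finV subset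
    by (intro card_SigmaI) (auto intro: finite_subset[of _ V])
  moreover have "(SIGMA v:V. {w. (v, w) \<in> E}) = E"
    using subset by auto
  ultimately show ?thesis by simp
qed

lemma finite_closed4: "finite closed4"
  by (rule finite_subset[of _ "V \<times> V \<times> V \<times> V"]) (use finV in \<open>auto simp: closed4_def dest: arcsD\<close>)

text \<open>A closed 4-walk that is not a 4-cycle has \<open>a = c\<close> or \<open>b = d\<close>.
  If \<open>a = c\<close>, then \<open>b\<close> and \<open>d\<close> are arbitrary neighbours of
  \<open>a\<close>, which gives the squared degrees. Rotation exchanges the two cases, and their
  overlap has one walk per arc.\<close>

lemma card_closed4: "card closed4 + card E = 2 * (\<Sum>v\<in>V. (deg v)\<^sup>2) + card cycles4"
proof -
  let ?B = "{(a, b, c, d) \<in> closed4. a = c}" and ?C = "{(a, b, c, d) \<in> closed4. b = d}"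
  have fin: "finite ?B" "finite ?C" "finite cycles4"
    using finite_closed4 by (auto intro: finite_subset simp: cycles4_def)
  have finN: "finite {w. (v, w) \<in> E}" for v
    using finV subset by (auto intro: finite_subset[of _ V])
  have "card ?B = card (SIGMA v:V. {w. (v, w) \<in> E} \<times> {w. (v, w) \<in> E})"
    by (intro bij_betw_same_card[of "\<lambda>(a, b, c, d). (a, b, d)"]
        bij_betw_byWitness[where f' = "\<lambda>(a, b, d). (a, b, a, d)"])
      (auto simp: closed4_def dest: arcsD)
  also have "\<dots> = (\<Sum>v\<in>V. (deg v)\<^sup>2)"
    using finV finN by (subst card_SigmaI) (auto simp: deg_def power2_eq_square card_cartesian_product)
  finally have B: "card ?B = (\<Sum>v\<in>V. (deg v)\<^sup>2)" .
  have "card ?B = card ?C"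
    by (intro bij_betw_same_card[of "\<lambda>(a, b, c, d). (b, c, d, a)"]
        bij_betw_byWitness[where f' = "\<lambda>(b, c, d, a). (a, b, c, d)"])
      (auto simp: closed4_def dest: arcsD)
  moreover have "card (?B \<inter> ?C) = card E"
    by (intro bij_betw_same_card[of "\<lambda>(a, b, c, d). (a, b)"]
        bij_betw_byWitness[where f' = "\<lambda>(a, b). (a, b, a, b)"])
      (auto simp: closed4_def dest: arcsD)
  moreover have "card ?B + card ?C = card (?B \<union> ?C) + card (?B \<inter> ?C)"
    by (rule card_Un_Int) (use fin in auto)
  moreover have "card closed4 = card (?B \<union> ?C) + card cycles4"
  proof -
    have eq: "closed4 = (?B \<union> ?C) \<union> cycles4"
      by (auto simp: cycles4_def)
    show ?thesis
      by (subst eq, rule card_Un_disjoint) (use fin in \<open>auto simp: cycles4_def\<close>)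
  qed
  ultimately show ?thesis using B by linarith
qed

end

subsection \<open>Bridges and connected components\<close>

lemma sum_power2_le_power2_sum:
  fixes f :: "'a \<Rightarrow> nat"
  assumes "finite A"
  shows "(\<Sum>x\<in>A. (f x)\<^sup>2) \<le> (\<Sum>x\<in>A. f x)\<^sup>2"
  using assms by induction (auto simp: power2_sum)

text \<open>With two positive terms, the square of the sum has a positive mixed product. This serves
  twice: for class sizes reduced by one and for degree excesses.\<close>

lemma sum_power2_less_power2_sum:
  fixes f :: "'a \<Rightarrow> nat"
  assumes A: "finite A" "A \<noteq> {}" and ex: "\<not> (\<exists>x\<in>A. \<forall>y\<in>A - {x}. f y = 0)"
  shows "(\<Sum>x\<in>A. (f x)\<^sup>2) < (\<Sum>x\<in>A. f x)\<^sup>2"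
proof -
  obtain x where x: "x \<in> A" "f x > 0" using ex A by fastforce
  define R where "R = (\<Sum>y\<in>A - {x}. f y)"
  have "R > 0" using ex x A unfolding R_def by (metis finite_Diff gr0I sum_eq_0_iff)
  have "(\<Sum>y\<in>A. (f y)\<^sup>2) \<le> (f x)\<^sup>2 + R\<^sup>2"
    using x A sum_power2_le_power2_sum[of "A - {x}" f] by (simp add: sum.remove R_def)
  also have "\<dots> < (f x + R)\<^sup>2"
    using x \<open>R > 0\<close> by (simp add: power2_sum)
  also have "f x + R = (\<Sum>y\<in>A. f y)"
    using x A by (simp add: sum.remove R_def)
  finally show ?thesis .
qed

definition n_comps :: "'a set \<Rightarrow> 'a rel \<Rightarrow> nat" where
  "n_comps V E = card (V // E\<^sup>*)"

lemma equiv_rtrancl: "sym E \<Longrightarrow> equiv UNIV (E\<^sup>*)"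
  by (auto simp: equiv_def refl_on_def sym_rtrancl trans_rtrancl)

lemma quotient_eq_image: "A // r = (\<lambda>v. r `` {v}) ` A"
  by (auto simp: quotient_def)

text \<open>A path can be shortened until it uses the new edge at most once, in one of the two
  directions.\<close>

lemma rtrancl_sym_insert:
  assumes "sym F"
  shows "(a, b) \<in> (insert (x, y) (insert (y, x) F))\<^sup>* \<longleftrightarrow>
    (a, b) \<in> F\<^sup>* \<or> (a, x) \<in> F\<^sup>* \<and> (y, b) \<in> F\<^sup>* \<or> (a, y) \<in> F\<^sup>* \<and> (x, b) \<in> F\<^sup>*"
  unfolding rtrancl_insert by (auto intro: rtrancl_trans)

text \<open>The edge merges the class of \<open>x\<close> with that of \<open>y\<close> and leaves
  the others alone. Once the class of \<open>x\<close> is dropped, passing to the coarser classes is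
  a bijection.\<close>

lemma n_comps_delete_edge:
  assumes V: "finite V" "x \<in> V" "y \<in> V" and F: "sym F" and disc: "(x, y) \<notin> F\<^sup>*"
  shows "n_comps V F = Suc (n_comps V (insert (x, y) (insert (y, x) F)))"
proof -
  define E where "E = insert (x, y) (insert (y, x) F)"
  let ?X = "F\<^sup>* `` {x}"
  have symE: "sym E" using F by (auto simp: E_def sym_def)
  note eF = equiv_rtrancl[OF F] and eE = equiv_rtrancl[OF symE]
  have FE: "F\<^sup>* \<subseteq> E\<^sup>*" by (rule rtrancl_mono) (auto simp: E_def)
  have classF: "F\<^sup>* `` {u} = F\<^sup>* `` {v} \<longleftrightarrow> (u, v) \<in> F\<^sup>*" for u v
    using eq_equiv_class_iff[OF eF] by auto
  have classE: "E\<^sup>* `` {u} = E\<^sup>* `` {v} \<longleftrightarrow> (u, v) \<in> E\<^sup>*" for u v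
    using eq_equiv_class_iff[OF eE] by auto
  have symF: "(u, v) \<in> F\<^sup>* \<Longrightarrow> (v, u) \<in> F\<^sup>*" for u v
    by (rule symD[OF sym_rtrancl[OF F]])
  have img: "E\<^sup>* `` (F\<^sup>* `` {v}) = E\<^sup>* `` {v}" for v
    using FE by (auto intro: rtrancl_trans)
  have "bij_betw (\<lambda>C. E\<^sup>* `` C) (V // F\<^sup>* - {?X}) (V // E\<^sup>*)"
  proof (rule bij_betw_imageI)
    show "inj_on (\<lambda>C. E\<^sup>* `` C) (V // F\<^sup>* - {?X})"
    proof (rule inj_onI)
      fix C D assume CD: "C \<in> V // F\<^sup>* - {?X}" "D \<in> V // F\<^sup>* - {?X}" "E\<^sup>* `` C = E\<^sup>* `` D"
      then obtain c d where cd: "C = F\<^sup>* `` {c}" "D = F\<^sup>* `` {d}"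
        by (auto simp: quotient_def)
      have "(c, x) \<notin> F\<^sup>*" "(d, x) \<notin> F\<^sup>*" using CD cd classF by auto
      moreover have "(c, d) \<in> E\<^sup>*" using CD(3) by (simp add: cd img classE)
      ultimately have "(c, d) \<in> F\<^sup>*"
        using symF unfolding E_def rtrancl_sym_insert[OF F] by blast
      then show "C = D" by (simp add: cd classF)
    qed
    show "(\<lambda>C. E\<^sup>* `` C) ` (V // F\<^sup>* - {?X}) = V // E\<^sup>*"
    proof (intro equalityI subsetI)
      fix D assume "D \<in> V // E\<^sup>*"
      then obtain d where d: "d \<in> V" "D = E\<^sup>* `` {d}" by (auto simp: quotient_def)
      show "D \<in> (\<lambda>C. E\<^sup>* `` C) ` (V // F\<^sup>* - {?X})"
      proof (cases "(d, x) \<in> F\<^sup>*")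
        case True
        have "(d, y) \<in> E\<^sup>*" using True unfolding E_def rtrancl_sym_insert[OF F] by blast
        then have "D = E\<^sup>* `` (F\<^sup>* `` {y})" by (simp add: d img classE)
        moreover have "F\<^sup>* `` {y} \<noteq> ?X" using disc classF symF by blast
        ultimately show ?thesis using V by (auto intro!: quotientI)
      next
        case False
        then have "F\<^sup>* `` {d} \<noteq> ?X" by (simp only: classF not_False_eq_True)
        then have "F\<^sup>* `` {d} \<in> V // F\<^sup>* - {?X}" using d(1) by (auto intro: quotientI)
        moreover have "D = E\<^sup>* `` (F\<^sup>* `` {d})" by (simp only: d img)
        ultimately show ?thesis by blast
      qed
    qed (auto simp: quotient_eq_image img)
  qed
  then have "card (V // F\<^sup>* - {?X}) = card (V // E\<^sup>*)"
    by (rule bij_betw_same_card)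
  moreover have "?X \<in> V // F\<^sup>*" "finite (V // F\<^sup>*)"
    using V by (auto simp: quotient_eq_image)
  ultimately show ?thesis
    unfolding n_comps_def E_def[symmetric] by (metis card_Suc_Diff1)
qed

context finite_graph
begin

text \<open>Reachability instead of a component count suits arguments with detours;
  \<open>cut_edges_eq_bridges\<close> identifies the two notions for connected graphs.\<close>

definition bridges :: "'a set set" where
  "bridges = {{x, y} |x y. (x, y) \<in> E \<and> (x, y) \<notin> (E - {(x, y), (y, x)})\<^sup>*}"

definition without :: "'a set set \<Rightarrow> 'a rel" where
  "without F = {(u, v) \<in> E. {u, v} \<notin> F}"

lemma sym_without: "sym (without F)"
  using symE by (auto simp: without_def sym_def insert_commute)

lemma sym_rtrancl_without: "(u, v) \<in> (without F)\<^sup>* \<Longrightarrow> (v, u) \<in> (without F)\<^sup>*"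
  by (rule symD[OF sym_rtrancl[OF sym_without]])

lemma without_singleton: "without {{x, y}} = E - {(x, y), (y, x)}"
  by (auto simp: without_def doubleton_eq_iff)

lemma bridges_iff: "{x, y} \<in> bridges \<longleftrightarrow> (x, y) \<in> E \<and> (x, y) \<notin> (without {{x, y}})\<^sup>*"
proof -
  have "(y, x) \<in> E \<and> (y, x) \<notin> (without {{x, y}})\<^sup>* \<longleftrightarrow> (x, y) \<in> E \<and> (x, y) \<notin> (without {{x, y}})\<^sup>*"
    using sym_rtrancl_without[of _ _ "{{x, y}}"] arcsD by blast
  then show ?thesis
    unfolding bridges_def without_singleton
    by (auto simp: doubleton_eq_iff insert_commute)
qed

lemma bridgesE:
  assumes "e \<in> bridges"
  obtains x y where "e = {x, y}" "(x, y) \<in> E" "(x, y) \<notin> (without {{x, y}})\<^sup>*"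
  using assms bridges_iff by (auto simp: bridges_def without_singleton)

lemma finite_bridges: "finite bridges"
proof (rule finite_subset)
  show "bridges \<subseteq> (\<lambda>(x, y). {x, y}) ` E" by (auto simp: bridges_def)
qed (simp add: finE)

lemma without_insert:
  assumes "(x, y) \<in> E" "{x, y} \<notin> F"
  shows "without F = insert (x, y) (insert (y, x) (without (insert {x, y} F)))"
  using assms arcsD[of x y] by (auto simp: without_def doubleton_eq_iff insert_commute)

text \<open>A bridge of \<open>E\<close> still separates its ends when other edges are gone, so each
  deletion adds exactly one component.\<close>

lemma n_comps_without_bridges:
  assumes "F \<subseteq> bridges"
  shows "n_comps V (without F) = n_comps V E + card F"
  using finite_subset[OF assms finite_bridges] assms
proof (induction F)
  case empty
  then show ?case by (simp add: without_def)
next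
  case (insert e F)
  obtain x y where e: "e = {x, y}" "(x, y) \<in> E" "(x, y) \<notin> (without {{x, y}})\<^sup>*"
    using insert.prems bridgesE by blast
  have "(without (insert e F))\<^sup>* \<subseteq> (without {{x, y}})\<^sup>*"
    by (rule rtrancl_mono) (auto simp: without_def e)
  then have "n_comps V (without (insert e F)) = Suc (n_comps V (without F))"
    unfolding e(1) without_insert[OF e(2) insert.hyps(2)[unfolded e(1)]]
    using e arcsD finV sym_without by (intro n_comps_delete_edge) auto
  then show ?case using insert by simp
qed

text \<open>If a bridge \<open>uv\<close> separated the ends of a detour around a non-bridge \<open>xy\<close>,
  then the detour together with \<open>xy\<close> would bypass \<open>uv\<close>.\<close>

lemma nonbridge_detour:
  assumes "(x, y) \<in> E" "{x, y} \<notin> bridges" "F \<subseteq> bridges"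
  shows "(x, y) \<in> (without (insert {x, y} F))\<^sup>*"
  using finite_subset[OF assms(3) finite_bridges] assms(3)
proof (induction F)
  case empty
  then show ?case using assms bridges_iff by auto
next
  case (insert e F)
  obtain u v where e: "e = {u, v}" "(u, v) \<in> E" "(u, v) \<notin> (without {{u, v}})\<^sup>*"
    using insert.prems bridgesE by blast
  have ne: "{u, v} \<noteq> {x, y}" using insert.prems assms(2) e by auto
  let ?R = "without (insert {u, v} (insert {x, y} F))"
  have sub: "?R\<^sup>* \<subseteq> (without {{u, v}})\<^sup>*"
    by (rule rtrancl_mono) (auto simp: without_def)
  have xy: "(x, y) \<in> (without {{u, v}})\<^sup>*"
    using assms(1) ne by (auto simp: without_def)
  have "(x, y) \<in> (without (insert {x, y} F))\<^sup>*" using insert by auto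
  then have "(x, y) \<in> ?R\<^sup>* \<or> (x, u) \<in> ?R\<^sup>* \<and> (v, y) \<in> ?R\<^sup>* \<or> (x, v) \<in> ?R\<^sup>* \<and> (u, y) \<in> ?R\<^sup>*"
    using without_insert[OF e(2), of "insert {x, y} F"] insert.hyps(2) ne e(1)
    by (simp add: rtrancl_sym_insert[OF sym_without])
  moreover have False if "(x, u) \<in> ?R\<^sup>*" "(v, y) \<in> ?R\<^sup>*"
    using that sub xy e(3) sym_rtrancl_without by (meson rtrancl_trans subsetD)
  moreover have False if "(x, v) \<in> ?R\<^sup>*" "(u, y) \<in> ?R\<^sup>*"
    using that sub xy e(3) sym_rtrancl_without by (meson rtrancl_trans subsetD)
  ultimately show ?case by (auto simp: e(1) insert_commute)
qed

end

subsection \<open>Classes of the graph without its bridges\<close>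

locale connected_graph = finite_graph +
  assumes nonempty: "V \<noteq> {}"
    and conn: "u \<in> V \<Longrightarrow> v \<in> V \<Longrightarrow> (u, v) \<in> E\<^sup>*"
begin

abbreviation core :: "'a rel" where
  "core \<equiv> without bridges"

text \<open>These are the 2-edge-connected components, single vertices included, and not the blocks
  defined by cut vertices.\<close>

definition blocks :: "'a set set" where
  "blocks = V // core\<^sup>*"

lemma core_subset: "core \<subseteq> E"
  by (auto simp: without_def)

lemma rtrancl_in_V:
  assumes "R \<subseteq> E" "(u, v) \<in> R\<^sup>*" "u \<in> V"
  shows "v \<in> V"
  using assms(2,3) by induction (use assms(1) subset in auto)

lemma n_comps_E: "n_comps V E = 1"
proof -
  have "E\<^sup>* `` {v} = V" if "v \<in> V" for v
    using that conn rtrancl_in_V[OF order.refl] by auto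
  then have "V // E\<^sup>* = {V}"
    using nonempty by (auto simp: quotient_eq_image)
  then show ?thesis by (simp add: n_comps_def)
qed

lemma card_blocks: "card blocks = Suc (card bridges)"
  using n_comps_without_bridges[OF order.refl] n_comps_E
  unfolding n_comps_def blocks_def by linarith

lemma finite_blocks: "finite blocks"
  unfolding blocks_def quotient_eq_image using finV by simp

lemma in_blocksE:
  assumes "C \<in> blocks"
  obtains v where "v \<in> V" "C = core\<^sup>* `` {v}"
  using assms by (auto simp: blocks_def quotient_def)

lemma class_subset: "C \<in> blocks \<Longrightarrow> C \<subseteq> V"
  using rtrancl_in_V[OF core_subset] by (auto elim: in_blocksE)

lemma finite_class: "C \<in> blocks \<Longrightarrow> finite C"
  using class_subset finV finite_subset by blast

lemma card_class_pos:
  assumes "C \<in> blocks"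
  shows "card C > 0"
proof -
  have "C \<noteq> {}" using assms by (auto elim: in_blocksE)
  then show ?thesis using finite_class[OF assms] by (simp add: card_gt_0_iff)
qed

lemma class_iff:
  assumes "C \<in> blocks" "u \<in> C"
  shows "v \<in> C \<longleftrightarrow> (u, v) \<in> core\<^sup>*"
proof -
  obtain w where w: "C = core\<^sup>* `` {w}" using assms(1) by (rule in_blocksE)
  then have "(w, u) \<in> core\<^sup>*" using assms(2) by simp
  then have "(w, v) \<in> core\<^sup>* \<longleftrightarrow> (u, v) \<in> core\<^sup>*"
    using rtrancl_trans[of w u core v] rtrancl_trans[of u w core v] sym_rtrancl_without[of w u] by auto
  then show ?thesis by (simp add: w)
qed

lemma blocks_disjoint:
  assumes "C \<in> blocks" "D \<in> blocks" "C \<noteq> D"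
  shows "C \<inter> D = {}"
proof (rule ccontr)
  assume "C \<inter> D \<noteq> {}"
  then obtain u where "u \<in> C" "u \<in> D" by auto
  then have "C = D"
    using class_iff[OF assms(1), of u] class_iff[OF assms(2), of u] by (simp add: set_eq_iff)
  then show False using assms(3) by contradiction
qed

lemma Union_blocks: "\<Union> blocks = V"
  using class_subset by (auto simp: blocks_def quotient_eq_image)

lemma sum_card_blocks: "(\<Sum>C\<in>blocks. card C) = card V"
  using card_Union_disjoint[of blocks] blocks_disjoint finite_class
  by (auto simp: Union_blocks pairwise_def disjnt_def)

section \<open>The largest possible number of edges\<close>

lemma card_core_rtrancl: "card (core\<^sup>* \<inter> V \<times> V) = (\<Sum>C\<in>blocks. (card C)\<^sup>2)"
proof -
  have "core\<^sup>* \<inter> V \<times> V = (\<Union>C\<in>blocks. C \<times> C)"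
  proof (intro equalityI subsetI)
    fix p assume "p \<in> core\<^sup>* \<inter> V \<times> V"
    then obtain u v where p: "p = (u, v)" "(u, v) \<in> core\<^sup>*" "u \<in> V" by auto
    then show "p \<in> (\<Union>C\<in>blocks. C \<times> C)"
      by (auto simp: blocks_def quotient_def)
  next
    fix p assume "p \<in> (\<Union>C\<in>blocks. C \<times> C)"
    then obtain C u v where C: "C \<in> blocks" "u \<in> C" "v \<in> C" "p = (u, v)" by auto
    then show "p \<in> core\<^sup>* \<inter> V \<times> V"
      using class_iff[OF C(1,2), of v] class_subset[OF C(1)] by auto
  qed
  also have "card \<dots> = (\<Sum>C\<in>blocks. card (C \<times> C))"
    using finite_blocks finite_class blocks_disjoint by (intro card_UN_disjoint) auto
  finally show ?thesis by (simp add: card_cartesian_product power2_eq_square)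
qed

lemma card_bridge_arcs: "card (E - core) = 2 * card bridges"
proof -
  have "E - core = (\<Union>e\<in>bridges. {(u, v). {u, v} = e})"
    using arcsD bridges_iff by (auto simp: without_def)
  also have "card \<dots> = (\<Sum>e\<in>bridges. card {(u, v). {u, v} = e})"
  proof (rule card_UN_disjoint)
    have "{(u, v). {u, v} = e} \<subseteq> E" if "e \<in> bridges" for e
      using that bridges_iff by auto
    then show "\<forall>e\<in>bridges. finite {(u, v). {u, v} = e}"
      using finE finite_subset by blast
  qed (auto simp: finite_bridges)
  also have "\<dots> = (\<Sum>e\<in>bridges. 2)"
  proof (rule sum.cong[OF refl])
    fix e assume "e \<in> bridges"
    then obtain x y where e: "e = {x, y}" "(x, y) \<in> E" by (auto elim: bridgesE)
    then have "x \<noteq> y" using arcsD by blast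
    have "{(u, v). {u, v} = e} = {(x, y), (y, x)}"
      by (auto simp: e doubleton_eq_iff)
    then show "card {(u, v). {u, v} = e} = 2" using \<open>x \<noteq> y\<close> by simp
  qed
  finally show ?thesis by simp
qed

text \<open>The \<open>q\<close> of the overview: the size of a class when all others are
  singletons.\<close>

definition core_size :: nat where
  "core_size = card V - card bridges"

lemma core_size_eq: "card V = core_size + card bridges" "core_size = Suc (\<Sum>C\<in>blocks. card C - 1)"
proof -
  have "card V = (\<Sum>C\<in>blocks. (card C - 1) + 1)"
    unfolding sum_card_blocks[symmetric] by (rule sum.cong) (use card_class_pos in fastforce)+
  also have "\<dots> = (\<Sum>C\<in>blocks. card C - 1) + Suc (card bridges)"
    unfolding sum.distrib by (simp add: card_blocks)
  finally show "card V = core_size + card bridges" "core_size = Suc (\<Sum>C\<in>blocks. card C - 1)"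
    by (auto simp: core_size_def)
qed

text \<open>Class sizes enter the edge bound only through the squares of their surpluses
  \<open>card C - 1\<close>. The additive form avoids truncated subtraction.\<close>

lemma sum_card_blocks_power2:
  "(\<Sum>C\<in>blocks. (card C)\<^sup>2) + (core_size - 1)\<^sup>2 = (\<Sum>C\<in>blocks. (card C - 1)\<^sup>2) + core_size\<^sup>2 + card bridges"
proof -
  have "(\<Sum>C\<in>blocks. (card C)\<^sup>2) = (\<Sum>C\<in>blocks. (card C - 1)\<^sup>2 + 2 * (card C - 1) + 1)"
  proof (rule sum.cong[OF refl])
    fix C assume "C \<in> blocks"
    then obtain m where "card C = Suc m" using card_class_pos gr0_implies_Suc by blast
    then show "(card C)\<^sup>2 = (card C - 1)\<^sup>2 + 2 * (card C - 1) + 1"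
      by (simp add: power2_eq_square)
  qed
  also have "\<dots> = (\<Sum>C\<in>blocks. (card C - 1)\<^sup>2) + 2 * (\<Sum>C\<in>blocks. card C - 1) + Suc (card bridges)"
    unfolding sum.distrib sum_distrib_left by (simp add: card_blocks)
  finally show ?thesis
    unfolding core_size_eq(2) by (simp add: power2_eq_square)
qed

text \<open>The right-hand side holds all arcs that could run inside classes, so equality means that
  every class is complete.\<close>

lemma core_off_diagonal: "core \<subseteq> core\<^sup>* \<inter> V \<times> V - Id"
  using core_subset arcsD by auto

lemma card_off_diagonal:
  "card (core\<^sup>* \<inter> V \<times> V - Id) + card V = (\<Sum>C\<in>blocks. (card C)\<^sup>2)"
proof -
  have "card (core\<^sup>* \<inter> V \<times> V) = card (core\<^sup>* \<inter> V \<times> V - Id) + card (core\<^sup>* \<inter> V \<times> V \<inter> Id)"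
    using finV by (metis card_Int_Diff finite_Int finite_SigmaI add.commute)
  moreover have "core\<^sup>* \<inter> V \<times> V \<inter> Id = (\<lambda>v. (v, v)) ` V" by auto
  moreover have "card ((\<lambda>v. (v, v)) ` V) = card V"
    by (simp add: card_image inj_on_def)
  ultimately show ?thesis by (simp add: card_core_rtrancl)
qed

lemma card_arcs: "card E = card core + 2 * card bridges"
  using card_bridge_arcs core_subset finE
  by (metis card_Diff_subset card_mono finite_subset le_add_diff_inverse)

lemma finite_off_diagonal: "finite (core\<^sup>* \<inter> V \<times> V - Id)"
  using finV by auto

lemma card_arcs_le: "card E + core_size \<le> core_size\<^sup>2 + 2 * card bridges"
proof -
  have "card core \<le> card (core\<^sup>* \<inter> V \<times> V - Id)"
    by (rule card_mono[OF finite_off_diagonal core_off_diagonal])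
  moreover have "(\<Sum>C\<in>blocks. (card C - 1)\<^sup>2) \<le> (core_size - 1)\<^sup>2"
    using sum_power2_le_power2_sum[OF finite_blocks, of "\<lambda>C. card C - 1"] core_size_eq(2) by simp
  ultimately show ?thesis
    using card_off_diagonal sum_card_blocks_power2 card_arcs core_size_eq(1) by linarith
qed

text \<open>Equality leaves no slack in either estimate behind \<open>card_arcs_le\<close>: the
  classes are complete, and one of them has all the surplus. In a tree, \<open>Q\<close> is just
  some singleton and \<open>core\<close> is empty.\<close>

lemma extremal_core:
  assumes ext: "card E + core_size = core_size\<^sup>2 + 2 * card bridges"
  obtains Q where "Q \<subseteq> V" "card Q = core_size" "core = Q \<times> Q - Id"
proof -
  have 1: "card core \<le> card (core\<^sup>* \<inter> V \<times> V - Id)"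
    by (rule card_mono[OF finite_off_diagonal core_off_diagonal])
  have 2: "(\<Sum>C\<in>blocks. (card C - 1)\<^sup>2) \<le> (core_size - 1)\<^sup>2"
    using sum_power2_le_power2_sum[OF finite_blocks, of "\<lambda>C. card C - 1"] core_size_eq(2) by simp
  have eq: "card core = card (core\<^sup>* \<inter> V \<times> V - Id)" "(\<Sum>C\<in>blocks. (card C - 1)\<^sup>2) = (core_size - 1)\<^sup>2"
    using 1 2 ext card_off_diagonal sum_card_blocks_power2 card_arcs core_size_eq(1) by linarith+
  have core: "core = core\<^sup>* \<inter> V \<times> V - Id"
    by (rule card_subset_eq[OF finite_off_diagonal core_off_diagonal eq(1)])
  have "blocks \<noteq> {}" using card_blocks by auto
  then obtain Q where Q: "Q \<in> blocks" "\<And>C. C \<in> blocks \<Longrightarrow> C \<noteq> Q \<Longrightarrow> card C - 1 = 0"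
    using sum_power2_less_power2_sum[OF finite_blocks, of "\<lambda>C. card C - 1"] eq(2) core_size_eq(2)
    by fastforce
  have "(\<Sum>C\<in>blocks. card C - 1) = card Q - 1"
    using Q finite_blocks by (simp add: sum.remove)
  then have "card Q = core_size" using core_size_eq(2) card_class_pos[OF Q(1)] by simp
  moreover have "core = Q \<times> Q - Id"
  proof (intro equalityI subsetI)
    fix p assume p: "p \<in> core"
    then obtain u v where uv: "p = (u, v)" "u \<in> V" "u \<noteq> v" "(u, v) \<in> core\<^sup>*"
      using subsetD[OF core_off_diagonal p] by auto
    then obtain C where C: "C \<in> blocks" "u \<in> C" using Union_blocks by auto
    then have "v \<in> C" using uv class_iff by auto
    have "C = Q"
    proof (rule ccontr)
      assume "C \<noteq> Q"
      then have "card C = 1" using Q(2)[OF C(1)] card_class_pos[OF C(1)] by simp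
      then show False using C(2) \<open>v \<in> C\<close> \<open>u \<noteq> v\<close> by (auto simp: card_1_singleton_iff)
    qed
    then show "p \<in> Q \<times> Q - Id" using C \<open>v \<in> C\<close> uv by auto
  next
    fix p assume "p \<in> Q \<times> Q - Id"
    then show "p \<in> core"
      using class_iff[OF Q(1)] class_subset[OF Q(1)] by (subst core) auto
  qed
  ultimately show ?thesis using that class_subset[OF Q(1)] by blast
qed

text \<open>A total surplus of 1 means a single class \<open>{a, b}\<close> of two vertices. Its
  edge is not a bridge, so a detour avoids it and all bridges; the first step of that detour would
  have to leave the class.\<close>

lemma core_size_not_2: "core_size \<noteq> 2"
proof
  assume "core_size = 2"
  then have sum1: "(\<Sum>C\<in>blocks. card C - 1) = 1" using core_size_eq(2) by simp
  then obtain C where C: "C \<in> blocks" "card C - 1 \<noteq> 0"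
    by (metis sum.neutral zero_neq_one)
  have "card C - 1 \<le> 1"
    using C sum1 finite_blocks by (metis member_le_sum zero_le)
  then have "card C = 2" using C by simp
  then obtain a b where ab: "C = {a, b}" "a \<noteq> b" by (auto simp: card_2_iff)
  then have "(a, b) \<in> core\<^sup>*" using class_iff[OF C(1)] by auto
  then obtain c where "(a, c) \<in> core" using ab(2) by (auto elim: converse_rtranclE)
  then have "c \<in> C" using class_iff[OF C(1), of a c] ab by auto
  then have "(a, b) \<in> core" using \<open>(a, c) \<in> core\<close> ab core_off_diagonal by auto
  then have "(a, b) \<in> (without (insert {a, b} bridges))\<^sup>*"
    using nonbridge_detour[OF _ _ order.refl, of a b] by (auto simp: without_def)
  then obtain d where d: "(a, d) \<in> without (insert {a, b} bridges)"
    using ab(2) by (auto elim: converse_rtranclE)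
  then have "(a, d) \<in> core" "d \<noteq> b" "d \<noteq> a" using arcsD by (auto simp: without_def)
  then show False using class_iff[OF C(1), of a d] ab by auto
qed

lemma bridges_subset_arcs: "2 * card bridges \<le> card E"
  using card_arcs by simp

end

subsection \<open>Cliques with pendant vertices\<close>

text \<open>The point is that the count depends on \<open>card A\<close> alone, which equates the
  numbers of triangles and 4-cycles in two graphs with equal core size.\<close>

lemma card_distinct_lists:
  assumes "finite A"
  shows "card {xs. length xs = k \<and> distinct xs \<and> set xs \<subseteq> A} =
    (if k \<le> card A then \<Prod>{card A - k + 1..card A} else 0)"
proof (cases "k \<le> card A")
  case True
  then show ?thesis using card_lists_distinct_length_eq[OF assms] by simp
next
  case False
  have "k \<le> card A" if "length xs = k" "distinct xs" "set xs \<subseteq> A" for xs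
    using that card_mono[OF assms, of "set xs"] distinct_card[of xs] by simp
  then have "{xs. length xs = k \<and> distinct xs \<and> set xs \<subseteq> A} = {}" using False by auto
  then show ?thesis using False by (simp only: card.empty if_False)
qed

text \<open>For \<open>v\<close> in \<open>Q\<close> this is \<open>K_n^k\<close> up to renaming,
  with \<open>n = card V\<close> and \<open>k = card V - card Q\<close>. It describes extremal
  graphs and \<open>K_pendant\<close> in the same terms.\<close>

definition clique_star :: "'a set \<Rightarrow> 'a set \<Rightarrow> 'a \<Rightarrow> 'a rel" where
  "clique_star V Q v = {(a, b) \<in> V \<times> V. a \<noteq> b \<and> (a \<in> Q \<and> b \<in> Q \<or> a = v \<or> b = v)}"

text \<open>The sum of the squared degrees of \<open>K_pendant (q + k) k\<close>.\<close>

definition star_deg2 :: "nat \<Rightarrow> nat \<Rightarrow> nat" where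
  "star_deg2 q k = (q - 1 + k)\<^sup>2 + (q - 1) ^ 3 + k"

text \<open>Write \<open>d = b + x\<close>. The mixed terms sum to at most \<open>2 * B * s\<close>,
  and the squares of \<open>x\<close> sum to less than \<open>s\<^sup>2\<close> unless one vertex
  carries everything. The bound \<open>s \<ge> 2\<close> is kept because it later forces
  \<open>n\<close> to be large enough.\<close>

lemma sum_power2_excess:
  fixes d b :: "'a \<Rightarrow> nat"
  assumes V: "finite V" "V \<noteq> {}"
    and le: "\<And>v. v \<in> V \<Longrightarrow> b v \<le> d v" "\<And>v. v \<in> V \<Longrightarrow> b v \<le> B"
    and sum: "(\<Sum>v\<in>V. d v) = (\<Sum>v\<in>V. b v) + s"
  obtains v where "v \<in> V" "d v = b v + s" "\<And>w. w \<in> V \<Longrightarrow> w \<noteq> v \<Longrightarrow> d w = b w"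
  | "(\<Sum>v\<in>V. (d v)\<^sup>2) < (\<Sum>v\<in>V. (b v)\<^sup>2) + 2 * B * s + s\<^sup>2" "s \<ge> 2"
proof -
  define x where "x v = d v - b v" for v
  have d: "d v = b v + x v" if "v \<in> V" for v using le(1)[OF that] by (simp add: x_def)
  have s: "(\<Sum>v\<in>V. x v) = s" using sum by (simp add: d sum.distrib)
  show ?thesis
  proof (cases "\<exists>v\<in>V. \<forall>w\<in>V - {v}. x w = 0")
    case True
    then obtain v where v: "v \<in> V" "\<forall>w\<in>V - {v}. x w = 0" by blast
    then have "x v = s" using s V by (simp add: sum.remove)
    then show ?thesis using that(1)[of v] v d by auto
  next
    case False
    have "(\<Sum>v\<in>V. (x v)\<^sup>2) < s\<^sup>2"
      using sum_power2_less_power2_sum[OF V False] s by simp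
    moreover have "(\<Sum>v\<in>V. (d v)\<^sup>2) = (\<Sum>v\<in>V. (b v)\<^sup>2) + 2 * (\<Sum>v\<in>V. b v * x v) + (\<Sum>v\<in>V. (x v)\<^sup>2)"
      by (simp add: d power2_sum sum.distrib sum_distrib_left mult.assoc)
    moreover have "(\<Sum>v\<in>V. b v * x v) \<le> B * s"
      unfolding s[symmetric] sum_distrib_left by (intro sum_mono mult_right_mono le) auto
    moreover have "s \<ge> 2"
    proof -
      have "s \<le> (\<Sum>v\<in>V. (x v)\<^sup>2)"
        unfolding s[symmetric] by (intro sum_mono) (simp add: power2_eq_square)
      then have "s < s\<^sup>2" using \<open>_ < s\<^sup>2\<close> by simp
      then have "s \<noteq> 0" "s \<noteq> 1" by (metis less_irrefl zero_power2, metis less_irrefl one_power2)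
      then show ?thesis by linarith
    qed
    ultimately show ?thesis using that(2) by simp
  qed
qed

section \<open>Triangles and 4-cycles avoid bridges; recognising clique stars\<close>

context finite_graph
begin

lemma finite_nbrs: "finite {w. (v, w) \<in> E}"
  using finV subset by (auto intro: finite_subset[of _ V])

lemma nonbridge_path2:
  assumes "(a, b) \<in> E" "(a, c) \<in> E" "(c, b) \<in> E"
  shows "(a, b) \<in> without bridges"
proof -
  have "c \<noteq> a" "c \<noteq> b" "a \<noteq> b" using assms arcsD by blast+
  then have "(a, c) \<in> without {{a, b}}" "(c, b) \<in> without {{a, b}}"
    using assms by (auto simp: without_def doubleton_eq_iff)
  then have "{a, b} \<notin> bridges"
    unfolding bridges_iff by (meson converse_rtrancl_into_rtrancl r_into_rtrancl)
  then show ?thesis using assms by (simp add: without_def)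
qed

text \<open>The rest of a 4-cycle is a detour around the edge; \<open>a \<noteq> c\<close> and
  \<open>b \<noteq> d\<close> keep the detour from using that edge.\<close>

lemma nonbridge_path3:
  assumes "(a, b) \<in> E" "(a, d) \<in> E" "(d, c) \<in> E" "(c, b) \<in> E" "a \<noteq> c" "b \<noteq> d"
  shows "(a, b) \<in> without bridges"
proof -
  have "(a, d) \<in> without {{a, b}}" "(d, c) \<in> without {{a, b}}" "(c, b) \<in> without {{a, b}}"
    using assms arcsD by (auto simp: without_def doubleton_eq_iff)
  then have "{a, b} \<notin> bridges"
    unfolding bridges_iff by (meson converse_rtrancl_into_rtrancl r_into_rtrancl)
  then show ?thesis using assms by (simp add: without_def)
qed

lemma closed3_eq_core:
  "closed3 = {(a, b, c). (a, b) \<in> without bridges \<and> (b, c) \<in> without bridges \<and> (c, a) \<in> without bridges}"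
  (is "_ = ?R")
proof (intro equalityI subsetI)
  fix p assume "p \<in> closed3"
  then obtain a b c where p: "p = (a, b, c)" and E: "(a, b) \<in> E" "(b, c) \<in> E" "(c, a) \<in> E"
    by (auto simp: closed3_def)
  have R: "(b, a) \<in> E" "(c, b) \<in> E" "(a, c) \<in> E"
    using E arcsD by blast+
  show "p \<in> ?R"
    using nonbridge_path2[of a b c] nonbridge_path2[of b c a] nonbridge_path2[of c a b] E R
    by (simp add: p)
qed (auto simp: closed3_def without_def)

lemma cycles4_eq_core:
  "cycles4 = {(a, b, c, d). (a, b) \<in> without bridges \<and> (b, c) \<in> without bridges \<and>
     (c, d) \<in> without bridges \<and> (d, a) \<in> without bridges \<and> a \<noteq> c \<and> b \<noteq> d}" (is "_ = ?R")
proof (intro equalityI subsetI)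
  fix p assume "p \<in> cycles4"
  then obtain a b c d where p: "p = (a, b, c, d)" and
    E: "(a, b) \<in> E" "(b, c) \<in> E" "(c, d) \<in> E" "(d, a) \<in> E" "a \<noteq> c" "b \<noteq> d"
    by (auto simp: cycles4_def closed4_def)
  have R: "(b, a) \<in> E" "(c, b) \<in> E" "(d, c) \<in> E" "(a, d) \<in> E"
    using E arcsD by blast+
  show "p \<in> ?R"
    using nonbridge_path3[of a b d c] nonbridge_path3[of b c a d]
      nonbridge_path3[of c d b a] nonbridge_path3[of d a c b] E R by (simp add: p)
qed (auto simp: cycles4_def closed4_def without_def)

lemma card_closed3_core:
  assumes core: "without bridges = Q \<times> Q - Id"
  shows "card closed3 = card {xs. length xs = 3 \<and> distinct xs \<and> set xs \<subseteq> Q}"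
proof -
  let ?f = "\<lambda>(a, b, c). [a, b, c]"
  have "{xs. length xs = 3 \<and> distinct xs \<and> set xs \<subseteq> Q} = ?f ` closed3"
  proof (intro equalityI subsetI)
    fix xs assume xs: "xs \<in> {xs. length xs = 3 \<and> distinct xs \<and> set xs \<subseteq> Q}"
    then obtain a b c where "xs = [a, b, c]" by (auto simp: length_Suc_conv numeral_3_eq_3)
    with xs show "xs \<in> ?f ` closed3"
      unfolding closed3_eq_core core by (intro image_eqI[of _ _ "(a, b, c)"]) auto
  qed (auto simp: closed3_eq_core core)
  moreover have "inj_on ?f closed3" by (auto simp: inj_on_def)
  ultimately show ?thesis by (simp only: card_image)
qed

lemma card_cycles4_core:
  assumes core: "without bridges = Q \<times> Q - Id"
  shows "card cycles4 = card {xs. length xs = 4 \<and> distinct xs \<and> set xs \<subseteq> Q}"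
proof -
  let ?f = "\<lambda>(a, b, c, d). [a, b, c, d]"
  have "{xs. length xs = 4 \<and> distinct xs \<and> set xs \<subseteq> Q} = ?f ` cycles4"
  proof (intro equalityI subsetI)
    fix xs assume xs: "xs \<in> {xs. length xs = 4 \<and> distinct xs \<and> set xs \<subseteq> Q}"
    then obtain a b c d where "xs = [a, b, c, d]" by (auto simp: length_Suc_conv numeral_4_eq_Suc)
    with xs show "xs \<in> ?f ` cycles4"
      unfolding cycles4_eq_core core by (intro image_eqI[of _ _ "(a, b, c, d)"]) auto
  qed (auto simp: cycles4_eq_core core)
  moreover have "inj_on ?f cycles4" by (auto simp: inj_on_def)
  ultimately show ?thesis by (simp only: card_image)
qed

text \<open>Neighbours already known use up the prescribed degrees: the centre sees every vertex,
  the clique vertices see the clique, and each other vertex sees the centre.\<close>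

lemma eq_clique_starI:
  assumes v: "v \<in> Q" "Q \<subseteq> V" and clique: "Q \<times> Q - Id \<subseteq> E"
    and deg: "deg v = card V - 1" "\<And>w. w \<in> Q \<Longrightarrow> w \<noteq> v \<Longrightarrow> deg w = card Q - 1"
      "\<And>w. w \<in> V \<Longrightarrow> w \<notin> Q \<Longrightarrow> deg w = 1"
  shows "E = clique_star V Q v"
proof -
  have "{w. (v, w) \<in> E} = V - {v}"
    using v arcsD deg(1) finV by (intro card_subset_eq) (auto simp: deg_def)
  then have nv: "(v, w) \<in> E \<longleftrightarrow> w \<in> V - {v}" for w by blast
  have nQ: "(a, w) \<in> E \<longleftrightarrow> w \<in> Q - {a}" if "a \<in> Q" "a \<noteq> v" for a w
  proof -
    have "Q - {a} \<subseteq> {w. (a, w) \<in> E}"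
      using that(1) clique by auto
    moreover have "card (Q - {a}) = card {w. (a, w) \<in> E}"
      using that(1) deg(2)[OF that] by (simp add: deg_def)
    ultimately have "Q - {a} = {w. (a, w) \<in> E}"
      by (intro card_subset_eq finite_nbrs)
    then show ?thesis by blast
  qed
  have n1: "(a, w) \<in> E \<longleftrightarrow> w = v" if "a \<in> V" "a \<notin> Q" for a w
  proof -
    have "(v, a) \<in> E" using nv that v by auto
    then have "{v} = {w. (a, w) \<in> E}"
      using deg(3)[OF that] arcsD by (intro card_subset_eq[OF finite_nbrs]) (auto simp: deg_def)
    then show ?thesis by blast
  qed
  show ?thesis
  proof (intro equalityI subrelI)
    fix a b assume "(a, b) \<in> E"
    then show "(a, b) \<in> clique_star V Q v"
      using nQ[of a b] n1[of a b] arcsD[of a b] by (auto simp: clique_star_def)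
  next
    fix a b assume "(a, b) \<in> clique_star V Q v"
    then have ab: "a \<in> V" "b \<in> V" "a \<noteq> b" "a \<in> Q \<and> b \<in> Q \<or> a = v \<or> b = v"
      by (auto simp: clique_star_def)
    then consider "(a, b) \<in> Q \<times> Q - Id" | "a = v" "b \<in> V - {v}" | "b = v" "a \<in> V - {v}"
      by auto
    then show "(a, b) \<in> E"
    proof cases
      case 1
      then show ?thesis using clique by blast
    next
      case 2
      then show ?thesis by (simp only: nv)
    next
      case 3
      then have "(v, a) \<in> E" by (simp only: nv)
      then show ?thesis using arcsD 3 by blast
    qed
  qed
qed

lemma clique_star_deg:
  assumes E: "E = clique_star V Q v" and v: "v \<in> Q" "Q \<subseteq> V"
  shows "deg v = card V - 1" "\<And>w. w \<in> Q \<Longrightarrow> w \<noteq> v \<Longrightarrow> deg w = card Q - 1"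
    "\<And>w. w \<in> V \<Longrightarrow> w \<notin> Q \<Longrightarrow> deg w = 1"
proof -
  have finQ: "finite Q" using v finV finite_subset by blast
  have "{w. (v, w) \<in> E} = V - {v}" using v by (auto simp: E clique_star_def)
  then show "deg v = card V - 1" using v finV by (auto simp: deg_def)
  show "deg w = card Q - 1" if "w \<in> Q" "w \<noteq> v" for w
  proof -
    have "{u. (w, u) \<in> E} = Q - {w}" using v that by (auto simp: E clique_star_def)
    then show ?thesis using that finQ by (simp add: deg_def)
  qed
  show "deg w = 1" if "w \<in> V" "w \<notin> Q" for w
  proof -
    have "{u. (w, u) \<in> E} = {v}" using v that by (auto simp: E clique_star_def)
    then show ?thesis by (simp add: deg_def)
  qed
qed

text \<open>A general \<open>f\<close> covers both the number of arcs (identity) and the sum of the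
  squared degrees.\<close>

lemma sum_clique_star:
  assumes E: "E = clique_star V Q v" and v: "v \<in> Q" "Q \<subseteq> V"
  shows "(\<Sum>w\<in>V. f (deg w)) = f (card V - 1) + (card Q - 1) * f (card Q - 1) + (card V - card Q) * f 1"
proof -
  have finQ: "finite Q" using v finV finite_subset by blast
  have "(\<Sum>w\<in>V. f (deg w)) = (\<Sum>w\<in>V - Q. f (deg w)) + (\<Sum>w\<in>Q. f (deg w))"
    using v finV by (metis add.commute sum.subset_diff)
  also have "(\<Sum>w\<in>V - Q. f (deg w)) = (\<Sum>w\<in>V - Q. f 1)"
    by (rule sum.cong) (auto simp: clique_star_deg[OF assms])
  also have "(\<Sum>w\<in>Q. f (deg w)) = f (deg v) + (\<Sum>w\<in>Q - {v}. f (deg w))"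
    using v finQ by (simp add: sum.remove)
  also have "(\<Sum>w\<in>Q - {v}. f (deg w)) = (\<Sum>w\<in>Q - {v}. f (card Q - 1))"
    by (rule sum.cong) (auto simp: clique_star_deg[OF assms])
  finally show ?thesis
    using v finQ by (simp add: clique_star_deg(1)[OF assms] card_Diff_subset)
qed

end

context finite_graph
begin

lemma clique_star_bridge:
  assumes E: "E = clique_star V Q v" and v: "v \<in> Q" "Q \<subseteq> V" and w: "w \<in> V - Q"
  shows "{v, w} \<in> bridges"
proof -
  have "(v, w) \<in> E" using v w by (auto simp: E clique_star_def)
  moreover have "(w, v) \<notin> (without {{v, w}})\<^sup>*"
  proof
    assume "(w, v) \<in> (without {{v, w}})\<^sup>*"
    then obtain z where "(w, z) \<in> without {{v, w}}"
      using v w by (auto elim: converse_rtranclE)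
    then have "(w, z) \<in> E" "z \<noteq> v" by (auto simp: without_def insert_commute)
    then show False using v w by (auto simp: E clique_star_def)
  qed
  ultimately show ?thesis
    using bridges_iff sym_rtrancl_without by blast
qed

text \<open>A third vertex of \<open>Q\<close> puts each clique edge into a triangle. If
  \<open>Q\<close> had two vertices, its edge would be one more bridge.\<close>

lemma bridges_clique_star:
  assumes E: "E = clique_star V Q v" and v: "v \<in> Q" "Q \<subseteq> V" and not2: "card Q \<noteq> 2"
  shows "bridges = (\<lambda>w. {v, w}) ` (V - Q)"
proof (intro equalityI subsetI)
  fix e assume e: "e \<in> bridges"
  then obtain a b where ab: "e = {a, b}" "(a, b) \<in> E" by (auto elim: bridgesE)
  show "e \<in> (\<lambda>w. {v, w}) ` (V - Q)"
  proof (cases "a \<in> Q \<and> b \<in> Q")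
    case True
    have finQ: "finite Q" using v finV finite_subset by blast
    have "a \<noteq> b" using ab arcsD by blast
    then have "card {a, b} = 2" by simp
    then have "Q \<noteq> {a, b}" using not2 by metis
    then obtain c where c: "c \<in> Q" "c \<noteq> a" "c \<noteq> b" using True by blast
    then have "(a, c) \<in> E" "(c, b) \<in> E"
      using True v by (auto simp: E clique_star_def)
    then have "{a, b} \<notin> bridges"
      using nonbridge_path2[OF ab(2)] by (auto simp: without_def)
    then show ?thesis using e ab by simp
  next
    case False
    then have "a = v \<and> b \<in> V - Q \<or> b = v \<and> a \<in> V - Q"
      using ab(2) v by (auto simp: E clique_star_def)
    then show ?thesis using ab(1) by (auto simp: insert_commute)
  qed
qed (use clique_star_bridge[OF E v] in auto)

lemma connected_clique_star:
  assumes E: "E = clique_star V Q v" and v: "v \<in> Q" "Q \<subseteq> V"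
  shows "connected_graph V E"
proof
  show "V \<noteq> {}" using v by auto
  have "(a, v) \<in> E\<^sup>* \<and> (v, a) \<in> E\<^sup>*" if "a \<in> V" for a
  proof (cases "a = v")
    case False
    then have "(a, v) \<in> E" "(v, a) \<in> E" using that v by (auto simp: E clique_star_def)
    then show ?thesis by blast
  qed simp
  then show "(a, b) \<in> E\<^sup>*" if "a \<in> V" "b \<in> V" for a b
    using that by (meson rtrancl_trans)
qed

end

section \<open>Degrees in graphs with the maximal number of edges\<close>

context connected_graph
begin

lemma deg_pos:
  assumes "card V \<ge> 2" "v \<in> V"
  shows "deg v \<ge> 1"
proof -
  have "V \<noteq> {v}" using assms by auto
  then obtain w where "w \<in> V" "w \<noteq> v" using assms by blast
  then have "(v, w) \<in> E\<^sup>*" using conn assms by blast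
  then obtain z where "(v, z) \<in> E" using \<open>w \<noteq> v\<close> by (auto elim: converse_rtranclE)
  then have "deg v \<noteq> 0" using finite_nbrs[of v] by (auto simp: deg_def)
  then show ?thesis by simp
qed

text \<open>Distinct neighbours of \<open>w\<close> give distinct bridges. This keeps the centre of
  an extremal graph inside the clique.\<close>

lemma deg_le_card_bridges:
  assumes "\<And>u. (w, u) \<notin> core"
  shows "deg w \<le> card bridges"
  unfolding deg_def
proof (rule card_inj_on_le[of "\<lambda>u. {w, u}"])
  show "(\<lambda>u. {w, u}) ` {u. (w, u) \<in> E} \<subseteq> bridges"
    using assms by (auto simp: without_def)
  show "inj_on (\<lambda>u. {w, u}) {u. (w, u) \<in> E}"
    by (auto simp: inj_on_def doubleton_eq_iff)
qed (rule finite_bridges)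

text \<open>The size conditions in the second alternative concern the range of the order: the fourth
  moment is compared unless \<open>n = 4\<close>, and then the graph is a tree.\<close>

lemma extremal_dichotomy:
  assumes ext: "card E + core_size = core_size\<^sup>2 + 2 * card bridges"
  obtains Q v where "Q \<subseteq> V" "card Q = core_size" "v \<in> Q" "E = clique_star V Q v"
  | "(\<Sum>v\<in>V. (deg v)\<^sup>2) < star_deg2 core_size (card bridges)"
    "card V = 4 \<Longrightarrow> core_size = 1" "card V \<ge> 4"
proof -
  let ?q = core_size and ?k = "card bridges"
  note n = core_size_eq(1)
  obtain Q where Q: "Q \<subseteq> V" "card Q = ?q" and core: "core = Q \<times> Q - Id"
    using extremal_core[OF ext] .
  have finQ: "finite Q" using Q finV finite_subset by blast
  have clique: "Q \<times> Q - Id \<subseteq> E" using core core_subset by simp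
  have "?q \<ge> 1" using core_size_eq(2) by simp
  then consider "?q = 1" "?k = 0" | "?q = 1" "?k \<ge> 1" | "?q \<ge> 3"
    using core_size_not_2 by linarith
  then show ?thesis
  proof cases
    case 1
    then have "card V = 1" using n by simp
    then have QV: "Q = V" using Q 1 finV by (metis card_subset_eq)
    obtain v where "V = {v}" using \<open>card V = 1\<close> by (auto simp: card_1_singleton_iff)
    then have "E = clique_star V Q v" using arcsD by (auto simp: clique_star_def)
    then show ?thesis using that(1)[of Q v] Q QV \<open>V = {v}\<close> by simp
  next
    case 2
    have "card V \<ge> 2" using n 2 by simp
    have E2: "card E = 2 * ?k" using ext 2 by simp
    \<comment> \<open>A tree has \<open>2 * k\<close> arcs and \<open>k + 1\<close> vertices, hence
      excess \<open>k - 1\<close> over degree 1.\<close>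
    have sum: "(\<Sum>v\<in>V. deg v) = (\<Sum>v\<in>V. 1) + (?k - 1)"
      using E2 2 n by (simp add: sum_deg)
    show ?thesis
    proof (rule sum_power2_excess[where b = "\<lambda>_. 1" and d = deg and B = 1, OF finV nonempty _ _ sum])
      show "1 \<le> deg v" if "v \<in> V" for v using deg_pos \<open>card V \<ge> 2\<close> that by blast
    next
      fix v assume v: "v \<in> V" "deg v = 1 + (?k - 1)" "\<And>w. w \<in> V \<Longrightarrow> w \<noteq> v \<Longrightarrow> deg w = 1"
      \<comment> \<open>In a tree all classes are singletons, and the one to be called \<open>Q\<close> is chosen only now.\<close>
      have "E = clique_star V {v} v"
        using v n 2 by (intro eq_clique_starI) auto
      then show ?thesis using that(1)[of "{v}" v] v 2 by simp
    next
      assume less: "(\<Sum>v\<in>V. (deg v)\<^sup>2) < (\<Sum>v\<in>V. 1\<^sup>2) + 2 * 1 * (?k - 1) + (?k - 1)\<^sup>2" and k: "2 \<le> ?k - 1"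
      obtain m where m: "?k = Suc m" using 2 by (cases ?k) auto
      have "(\<Sum>v\<in>V. 1\<^sup>2) + 2 * 1 * (?k - 1) + (?k - 1)\<^sup>2 = star_deg2 ?q ?k"
        using n 2 m by (simp add: star_deg2_def power2_eq_square)
      then show ?thesis using that(2) less k n 2 by simp
    qed simp
  next
    case 3
    obtain m where m: "?q = Suc m" using 3 by (cases ?q) auto
    \<comment> \<open>Clique edges guarantee \<open>q - 1\<close> on \<open>Q\<close>, and
      connectedness guarantees 1 outside.\<close>
    let ?b = "\<lambda>v. if v \<in> Q then ?q - 1 else 1"
    have split: "(\<Sum>v\<in>V. if v \<in> Q then x else y) = ?q * x + ?k * y" for x y :: nat
    proof -
      have "V \<inter> {v. v \<in> Q} = Q" "V \<inter> - {v. v \<in> Q} = V - Q" using Q by auto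
      then show ?thesis
        using Q finV finQ n by (simp add: sum.If_cases card_Diff_subset)
    qed
    have ge: "?b v \<le> deg v" if "v \<in> V" for v
    proof (cases "v \<in> Q")
      case True
      have "Q - {v} \<subseteq> {w. (v, w) \<in> E}" using True clique by auto
      then have "card (Q - {v}) \<le> deg v"
        unfolding deg_def by (rule card_mono[OF finite_nbrs])
      then show ?thesis using True Q by simp
    next
      case False
      then show ?thesis using deg_pos[OF _ that] n 3 by simp
    qed
    \<comment> \<open>There are \<open>q * (q - 1) + 2 * k\<close> arcs, and the baseline totals
      \<open>q * (q - 1) + k\<close>.\<close>
    have sum: "(\<Sum>v\<in>V. deg v) = (\<Sum>v\<in>V. ?b v) + ?k"
      using ext m by (simp add: sum_deg split power2_eq_square)
    show ?thesis
    proof (rule sum_power2_excess[where b = ?b and d = deg and B = "?q - 1", OF finV nonempty ge _ sum])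
      fix v assume v: "v \<in> V" "deg v = ?b v + ?k" "\<And>w. w \<in> V \<Longrightarrow> w \<noteq> v \<Longrightarrow> deg w = ?b w"
      \<comment> \<open>Concentration alone would allow a vertex outside \<open>Q\<close> to carry
        the excess. Its degree would be \<open>k + 1\<close>, yet all its edges are bridges, and
        there are only \<open>k\<close>.\<close>
      have "v \<in> Q"
      proof (rule ccontr)
        assume "v \<notin> Q"
        then have "deg v \<le> ?k" using core by (intro deg_le_card_bridges) auto
        then show False using v(2) \<open>v \<notin> Q\<close> by simp
      qed
      have "deg w = 1" if "w \<in> V" "w \<notin> Q" for w
        using v(3)[OF that(1)] that(2) \<open>v \<in> Q\<close> by auto
      then have "E = clique_star V Q v"
        using v Q \<open>v \<in> Q\<close> clique n 3 by (intro eq_clique_starI) auto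
      then show ?thesis using that(1) Q \<open>v \<in> Q\<close> by blast
    next
      assume less: "(\<Sum>v\<in>V. (deg v)\<^sup>2) < (\<Sum>v\<in>V. (?b v)\<^sup>2) + 2 * (?q - 1) * ?k + ?k\<^sup>2" and k: "2 \<le> ?k"
      have "(\<Sum>v\<in>V. (?b v)\<^sup>2) = ?q * (?q - 1)\<^sup>2 + ?k"
        unfolding if_distrib[of "\<lambda>x. x\<^sup>2"] split by simp
      \<comment> \<open>By \<open>q * (q - 1)\<^sup>2 = (q - 1)\<^sup>2 + (q - 1) ^ 3\<close>, the
        bound is the value reached when a clique vertex takes the whole excess.\<close>
      then have "(\<Sum>v\<in>V. (?b v)\<^sup>2) + 2 * (?q - 1) * ?k + ?k\<^sup>2 = star_deg2 ?q ?k"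
        using m by (simp add: star_deg2_def power2_eq_square power3_eq_cube algebra_simps)
      then show ?thesis using that(2) less k n 3 by simp
    qed (use 3 in auto)
  qed
qed

lemma clique_star_counts:
  assumes E: "E = clique_star V Q v" and v: "v \<in> Q" "Q \<subseteq> V" and not2: "card Q \<noteq> 2"
  shows "card bridges = card V - card Q" "core_size = card Q"
    "card E + core_size = core_size\<^sup>2 + 2 * card bridges"
    "(\<Sum>v\<in>V. (deg v)\<^sup>2) = star_deg2 core_size (card bridges)"
proof -
  have finQ: "finite Q" using v finV finite_subset by blast
  have le: "card Q \<le> card V" using v finV by (simp add: card_mono)
  have "card bridges = card (V - Q)"
    unfolding bridges_clique_star[OF assms]
    by (rule card_image) (auto simp: inj_on_def doubleton_eq_iff)
  then show k: "card bridges = card V - card Q"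
    using v finQ by (simp add: card_Diff_subset)
  then show q: "core_size = card Q"
    using core_size_eq(1) le by simp
  have "card Q \<noteq> 0" using v finQ by auto
  \<comment> \<open>Here \<open>m\<close> is \<open>q - 1\<close> and \<open>j\<close> below is the
    number of pendant vertices, which removes truncated subtraction.\<close>
  then obtain m where m: "card Q = Suc m" by (cases "card Q") auto
  obtain j where j: "card V = Suc m + j" using le m by (metis le_Suc_ex)
  show "card E + core_size = core_size\<^sup>2 + 2 * card bridges"
    using sum_clique_star[OF E v, of "\<lambda>x. x"]
    by (simp add: sum_deg k q m j power2_eq_square)
  show "(\<Sum>v\<in>V. (deg v)\<^sup>2) = star_deg2 core_size (card bridges)"
    using sum_clique_star[OF E v, of "\<lambda>x. x\<^sup>2"]
    by (simp add: k q m j star_deg2_def power2_eq_square power3_eq_cube)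
qed

end

subsection \<open>Passage to the library graphs\<close>

lemma finite_graph_pair_graph:
  assumes "pair_graph G"
  shows "finite_graph (pverts G) (parcs G)"
proof -
  interpret pair_graph G by (fact assms)
  show ?thesis
  proof
    show "finite (pverts G)" by (rule pair_finite_verts)
    show "parcs G \<subseteq> pverts G \<times> pverts G" using in_arcsD1 in_arcsD2 by auto
    show "sym (parcs G)" using pair_sym_arcs by (simp add: symmetric_def)
    show "irrefl (parcs G)"
    proof (rule irreflI)
      show "(a, a) \<notin> parcs G" for a using pair_no_loops[of "(a, a)"] by auto
    qed
  qed
qed

lemma pair_graph_finite_graph:
  assumes "finite_graph (pverts G) (parcs G)"
  shows "pair_graph G"
proof -
  interpret finite_graph "pverts G" "parcs G" by (fact assms)
  show ?thesis
    by unfold_locales (use finV finE arcsD symE in \<open>auto simp: symmetric_def\<close>)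
qed

lemma rtrancl_on_iff_rtrancl:
  assumes "E \<subseteq> V \<times> V"
  shows "(u, v) \<in> rtrancl_on V E \<longleftrightarrow> u \<in> V \<and> (u, v) \<in> E\<^sup>*"
proof
  assume "(u, v) \<in> rtrancl_on V E"
  then show "u \<in> V \<and> (u, v) \<in> E\<^sup>*"
    by (auto dest: in_rtrancl_on_in_F(1) rtrancl_on_rtranclI)
next
  assume "u \<in> V \<and> (u, v) \<in> E\<^sup>*"
  then have "(u, v) \<in> E\<^sup>*" "u \<in> V" by auto
  then show "(u, v) \<in> rtrancl_on V E"
  proof induction
    case base
    then show ?case by (rule rtrancl_on_refl)
  next
    case (step y z)
    then have "z \<in> V" using assms by auto
    with step show ?case by (intro rtrancl_on_into_rtrancl_on[of u y V E z])
  qed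
qed

lemma reachable_with_proj_iff:
  assumes "parcs G \<subseteq> pverts G \<times> pverts G"
  shows "u \<rightarrow>\<^sup>*\<^bsub>with_proj G\<^esub> v \<longleftrightarrow> u \<in> pverts G \<and> (u, v) \<in> (parcs G)\<^sup>*"
  unfolding reachable_def with_proj_simps by (rule rtrancl_on_iff_rtrancl[OF assms])

text \<open>For symmetric arcs, reachability is mutual, so maximal mutually reachable sets are the
  classes of the closure.\<close>

lemma card_sccs_eq_n_comps:
  assumes "pair_graph G"
  shows "card (pre_digraph.sccs (with_proj G)) = n_comps (pverts G) (parcs G)"
proof -
  interpret pair_graph G by (fact assms)
  interpret finite_graph "pverts G" "parcs G" by (rule finite_graph_pair_graph[OF assms])
  let ?R = "(parcs G)\<^sup>*"
  note reach = reachable_with_proj_iff[OF subset]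
  have symR: "(u, v) \<in> ?R \<Longrightarrow> (v, u) \<in> ?R" for u v
    by (rule symD[OF sym_rtrancl[OF symE]])
  have closed: "v \<in> pverts G" if "u \<in> pverts G" "(u, v) \<in> ?R" for u v
    using that(2,1) by induction (use subset in auto)
  have "sccs_verts = pverts G // ?R"
  proof (intro equalityI subsetI)
    fix S assume S: "S \<in> sccs_verts"
    then obtain u where u: "u \<in> S" by (auto simp: in_sccs_verts_conv_reachable)
    have uV: "u \<in> pverts G" using S u by (auto simp: in_sccs_verts_conv_reachable reach)
    have "v \<in> S \<longleftrightarrow> (u, v) \<in> ?R" for v
    proof
      assume "v \<in> S"
      then show "(u, v) \<in> ?R" using S u by (simp add: in_sccs_verts_conv_reachable reach)
    next
      assume uv: "(u, v) \<in> ?R"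
      show "v \<in> S"
      \<comment> \<open>The maximality clause says that a vertex outside \<open>S\<close> is not
        mutually reachable with \<open>u\<close>.\<close>
      proof (rule ccontr)
        assume "v \<notin> S"
        then show False
          using S u uV uv closed[OF uV uv] symR[OF uv] by (simp add: in_sccs_verts_conv_reachable reach)
      qed
    qed
    then have "S = ?R `` {u}" by auto
    then show "S \<in> pverts G // ?R" using uV by (auto intro: quotientI)
  next
    fix S assume "S \<in> pverts G // ?R"
    then obtain u where u: "u \<in> pverts G" "S = ?R `` {u}" by (auto simp: quotient_def)
    show "S \<in> sccs_verts"
      unfolding in_sccs_verts_conv_reachable reach u(2)
    proof (intro conjI ballI allI impI)
      show "?R `` {u} \<noteq> {}" by auto
      fix a assume a: "a \<in> ?R `` {u}"
      show "a \<in> pverts G" using a closed u by auto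
      show "(a, b) \<in> ?R" if "b \<in> ?R `` {u}" for b
        using that a symR rtrancl_trans by (meson Image_singleton_iff)
      show "\<not> (a \<in> pverts G \<and> (a, b) \<in> ?R) \<or> \<not> (b \<in> pverts G \<and> (b, a) \<in> ?R)" if "b \<notin> ?R `` {u}" for b
        using that a rtrancl_trans[of u a "parcs G" b] by auto
    qed
  qed
  then show ?thesis by (simp add: n_comps_def flip: card_sccs_verts)
qed

lemma connected_with_proj_iff:
  assumes "pair_graph G"
  shows "Digraph_Component.connected (with_proj G) \<longleftrightarrow> connected_graph (pverts G) (parcs G)"
proof -
  interpret finite_graph "pverts G" "parcs G" by (rule finite_graph_pair_graph[OF assms])
  have sym: "mk_symmetric (with_proj G) = G"
    using arcsD by (auto simp: mk_symmetric_def split: prod.splits intro!: pair_pre_digraph.equality)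
  show ?thesis
    unfolding Digraph_Component.connected_def sym strongly_connected_def reachable_with_proj_iff[OF subset]
      connected_graph_def connected_graph_axioms_def
    using finite_graph_axioms by auto
qed

text \<open>Deleting a non-bridge leaves reachability as it was. Hence the count 2 in
  \<open>cut_edges\<close> singles out the bridges.\<close>

lemma (in connected_graph) n_comps_without_edge:
  assumes "(x, y) \<in> E"
  shows "n_comps V (without {{x, y}}) = (if {x, y} \<in> bridges then 2 else 1)"
proof (cases "{x, y} \<in> bridges")
  case True
  then show ?thesis
    using n_comps_without_bridges[of "{{x, y}}"] n_comps_E by simp
next
  case False
  then have xy: "(x, y) \<in> (without {{x, y}})\<^sup>*"
    using assms by (simp add: bridges_iff)
  have E: "E = insert (x, y) (insert (y, x) (without {{x, y}}))"
    using without_insert[OF assms, of "{}"] by (simp add: without_def)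
  have "E\<^sup>* = (without {{x, y}})\<^sup>*"
  proof (intro equalityI subrelI)
    fix a b assume "(a, b) \<in> E\<^sup>*"
    then show "(a, b) \<in> (without {{x, y}})\<^sup>*"
      using xy sym_rtrancl_without[OF xy]
      by (subst (asm) E, subst (asm) rtrancl_sym_insert[OF sym_without]) (meson rtrancl_trans)
  next
    fix a b assume "(a, b) \<in> (without {{x, y}})\<^sup>*"
    then show "(a, b) \<in> E\<^sup>*"
      by (rule rtrancl_mono[THEN subsetD, rotated]) (auto simp: without_def)
  qed
  then show ?thesis using n_comps_E False by (simp add: n_comps_def)
qed

lemma cut_edges_eq_bridges:
  assumes G: "pair_graph G" and conn: "connected_graph (pverts G) (parcs G)"
  shows "cut_edges G = finite_graph.bridges (parcs G)"
proof -
  interpret connected_graph "pverts G" "parcs G" by (fact conn)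
  have "card (pre_digraph.sccs (with_proj (delete_edge G {x, y}))) = (if {x, y} \<in> bridges then 2 else 1)"
    if "(x, y) \<in> parcs G" for x y
  proof -
    have D: "pverts (delete_edge G {x, y}) = pverts G" "parcs (delete_edge G {x, y}) = without {{x, y}}"
      by (auto simp: delete_edge_def without_def)
    have "finite_graph (pverts G) (without {{x, y}})"
    proof
      show "without {{x, y}} \<subseteq> pverts G \<times> pverts G" using subset by (auto simp: without_def)
      show "irrefl (without {{x, y}})" using irreflE by (auto simp: without_def irrefl_def)
    qed (fact finV sym_without)+
    then have "pair_graph (delete_edge G {x, y})"
      by (intro pair_graph_finite_graph) (simp add: D)
    from card_sccs_eq_n_comps[OF this] show ?thesis
      unfolding D n_comps_without_edge[OF that] .
  qed
  then have edge: "e \<in> cut_edges G \<longleftrightarrow> e \<in> bridges" if "e = {x, y}" "(x, y) \<in> parcs G" for e x y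
    using that by (auto simp: cut_edges_def edges_def)
  show ?thesis
  proof (rule Set.set_eqI)
    fix e
    show "e \<in> cut_edges G \<longleftrightarrow> e \<in> bridges"
    proof (cases "\<exists>x y. e = {x, y} \<and> (x, y) \<in> parcs G")
      case True
      then show ?thesis using edge by blast
    next
      case False
      then show ?thesis by (auto simp: cut_edges_def edges_def bridges_def)
    qed
  qed
qed

lemma graphs_with_cut_edges_iff:
  "G \<in> graphs_with_cut_edges n k \<longleftrightarrow> pair_graph G \<and> connected_graph (pverts G) (parcs G) \<and>
     card (pverts G) = n \<and> card (finite_graph.bridges (parcs G)) = k"
  by (auto simp: graphs_with_cut_edges_def connected_with_proj_iff cut_edges_eq_bridges)

lemma spectral_moments:
  assumes G: "pair_graph G"
  shows "spectral_moment 0 G = card (pverts G)"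
    "spectral_moment 1 G = 0"
    "spectral_moment 2 G = card (parcs G)"
    "spectral_moment 3 G = card (finite_graph.closed3 (parcs G))"
    "spectral_moment 4 G = card (finite_graph.closed4 (parcs G))"
proof -
  interpret finite_graph "pverts G" "parcs G" by (rule finite_graph_pair_graph[OF G])
  note m = spectral_moment_eq_closed_walks[OF G]
  show "spectral_moment 0 G = card (pverts G)" by (simp add: m)
  show "spectral_moment 1 G = 0" unfolding m sum_walk_count_1 by simp
  show "spectral_moment 2 G = card (parcs G)" unfolding m sum_walk_count_2 ..
  show "spectral_moment 3 G = card closed3" unfolding m sum_walk_count_3 ..
  show "spectral_moment 4 G = card closed4" unfolding m sum_walk_count_4 ..
qed

text \<open>Sizes suffice: \<open>clique_star\<close> refers only to membership in \<open>Q\<close>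
  and equality with the centre, so any bijections of the other clique vertices and of the pendant
  vertices can be glued along \<open>v\<close> and \<open>w\<close>.\<close>

lemma clique_star_iso:
  assumes G: "pair_graph G" and H: "pverts H = W" "parcs H = clique_star W R w" "w \<in> R" "R \<subseteq> W" "finite W"
    and Q: "parcs G = clique_star (pverts G) Q v" "v \<in> Q" "Q \<subseteq> pverts G"
    and card: "card (pverts G) = card W" "card Q = card R"
  shows "digraph_iso (with_proj G) (with_proj H)"
proof -
  interpret pair_graph G by (fact G)
  let ?V = "pverts G"
  have finQ: "finite Q" "finite R" using Q(3) H(4,5) finite_subset pair_finite_verts by blast+
  have "card (Q - {v}) = card (R - {w})" "card (?V - Q) = card (W - R)"
    using Q(2,3) H(3,4) card finQ by (simp_all add: card_Diff_subset)
  then obtain f g where f: "bij_betw f (Q - {v}) (R - {w})" and g: "bij_betw g (?V - Q) (W - R)"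
    using finQ H(5) pair_finite_verts finite_same_card_bij by (metis finite_Diff)
  define h where "h x = (if x = v then w else if x \<in> Q then f x else g x)" for x
  have "bij_betw h (Q - {v}) (R - {w})"
    using f by (rule bij_betw_cong[THEN iffD1, rotated]) (auto simp: h_def)
  moreover have "bij_betw h {v} {w}" by (simp add: h_def)
  ultimately have "bij_betw h ((Q - {v}) \<union> {v}) ((R - {w}) \<union> {w})"
    by (rule bij_betw_combine) auto
  then have hQ: "bij_betw h Q R" using Q(2) H(3) by (simp add: insert_absorb)
  moreover have "bij_betw h (?V - Q) (W - R)"
    using g by (rule bij_betw_cong[THEN iffD1, rotated]) (use Q(2) in \<open>auto simp: h_def\<close>)
  ultimately have "bij_betw h (Q \<union> (?V - Q)) (R \<union> (W - R))"
    by (rule bij_betw_combine) auto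
  moreover have "Q \<union> (?V - Q) = ?V" "R \<union> (W - R) = W" using Q(3) H(4) by auto
  ultimately have hV: "bij_betw h ?V W" by simp
  have hv: "h v = w" by (simp add: h_def)
  have inj: "inj_on h ?V" and img: "h ` ?V = W" "h ` Q = R"
    using hV hQ by (auto simp: bij_betw_def)
  have memQ: "h x \<in> R \<longleftrightarrow> x \<in> Q" if "x \<in> ?V" for x
    using inj img(2) that Q(3) by (metis inj_on_image_mem_iff)
  have memv: "h x = w \<longleftrightarrow> x = v" if "x \<in> ?V" for x
    using inj hv that Q(2,3) by (metis inj_on_def subsetD)
  have arcs: "(\<lambda>(x, y). (h x, h y)) ` parcs G = parcs H"
  proof (intro equalityI subsetI)
    fix p assume "p \<in> (\<lambda>(x, y). (h x, h y)) ` parcs G"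
    then obtain x y where p: "p = (h x, h y)" "(x, y) \<in> clique_star ?V Q v" using Q(1) by auto
    then have xy: "x \<in> ?V" "y \<in> ?V" "x \<noteq> y" by (auto simp: clique_star_def)
    then have "h x \<noteq> h y" using inj by (auto simp: inj_on_def)
    then show "p \<in> parcs H"
      using p xy memQ[OF xy(1)] memQ[OF xy(2)] memv[OF xy(1)] memv[OF xy(2)] img(1)
      by (auto simp: H clique_star_def)
  next
    fix p assume p: "p \<in> parcs H"
    then obtain a b where ab: "p = (a, b)" "a \<in> W" "b \<in> W" by (auto simp: H clique_star_def)
    then obtain x y where xy: "x \<in> ?V" "y \<in> ?V" "a = h x" "b = h y" using img(1) by blast
    then have "(x, y) \<in> parcs G"
      using p ab memQ[OF xy(1)] memQ[OF xy(2)] memv[OF xy(1)] memv[OF xy(2)]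
      by (auto simp: H Q(1) clique_star_def)
    then show "p \<in> (\<lambda>(x, y). (h x, h y)) ` parcs G"
      using ab(1) xy(3,4) by force
  qed
  \<comment> \<open>Arcs of the image are again pairs, so its tail and head maps are the
    projections.\<close>
  define iso where "iso = \<lparr>iso_verts = h, iso_arcs = (\<lambda>(x, y). (h x, h y)), iso_head = snd, iso_tail = fst\<rparr>"
  have "digraph_isomorphism iso"
    unfolding digraph_isomorphism_def
  proof (intro conjI ballI)
    show "wf_digraph (with_proj G)" by unfold_locales
    show "inj_on (iso_verts iso) (pverts G)" using inj by (simp add: iso_def)
    show "inj_on (iso_arcs iso) (parcs G)"
      using inj in_arcsD1 in_arcsD2 by (auto simp: iso_def inj_on_def)
  qed (auto simp: iso_def)
  moreover have "with_proj H = app_iso iso (with_proj G)"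
    using arcs img(1) by (simp add: app_iso_def iso_def with_proj_def H(1))
  ultimately show ?thesis unfolding digraph_iso_def by blast
qed

section \<open>The extremal graph and the comparison\<close>

lemma parcs_K_pendant:
  assumes "k < n"
  shows "parcs (K_pendant n k) = clique_star {0..<n} {0..<n - k} 0"
  using assms by (auto simp: K_pendant_def clique_star_def)

lemma K_pendant_in_graphs_with_cut_edges:
  assumes k: "k < n" "n - k \<noteq> 2"
  shows "K_pendant n k \<in> graphs_with_cut_edges n k"
proof -
  have V: "pverts (K_pendant n k) = {0..<n}" by (simp add: K_pendant_def)
  note E = parcs_K_pendant[OF k(1)]
  have fg: "finite_graph {0..<n} (clique_star {0..<n} {0..<n - k} 0)"
    by unfold_locales (auto simp: clique_star_def sym_def irrefl_def)
  interpret finite_graph "{0..<n}" "clique_star {0..<n} {0..<n - k} 0" by (fact fg)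
  have Q: "0 \<in> {0..<n - k}" "{0..<n - k} \<subseteq> {0..<n}" using k by auto
  interpret connected_graph "{0..<n}" "clique_star {0..<n} {0..<n - k} 0"
    by (rule connected_clique_star[OF refl Q])
  have "card bridges = k"
    using clique_star_counts(1)[OF refl Q] k by simp
  then show ?thesis
    unfolding graphs_with_cut_edges_iff V E
    using pair_graph_finite_graph[of "K_pendant n k"] fg connected_graph_axioms by (simp add: V E)
qed

text \<open>In this form the counts for \<open>G\<close> and for \<open>K_pendant\<close>, on
  different vertex types, both reduce to \<open>card_distinct_lists\<close>.\<close>

lemma (in connected_graph) extremal_closed_walks:
  assumes ext: "card E + core_size = core_size\<^sup>2 + 2 * card bridges"
  obtains Q :: "'a set" where "finite Q" "card Q = core_size"
    "card closed3 = card {xs. length xs = 3 \<and> distinct xs \<and> set xs \<subseteq> Q}"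
    "card cycles4 = card {xs. length xs = 4 \<and> distinct xs \<and> set xs \<subseteq> Q}"
proof -
  obtain Q where Q: "Q \<subseteq> V" "card Q = core_size" "core = Q \<times> Q - Id"
    using extremal_core[OF ext] .
  show ?thesis
    by (rule that[OF finite_subset[OF Q(1) finV] Q(2) card_closed3_core[OF Q(3)] card_cycles4_core[OF Q(3)]])
qed

lemma S_less_K_pendant:
  fixes G :: "'a pair_pre_digraph"
  assumes G: "G \<in> graphs_with_cut_edges n k" and not43: "(n, k) \<noteq> (4, 3)"
    and niso: "\<not> digraph_iso (with_proj G) (with_proj (K_pendant n k))"
  shows "G \<prec>\<^sub>s K_pendant n k"
proof -
  let ?K = "K_pendant n k"
  have pG: "pair_graph G" and cG: "connected_graph (pverts G) (parcs G)"
    and nG: "card (pverts G) = n" and kG: "card (finite_graph.bridges (parcs G)) = k"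
    using G by (auto simp: graphs_with_cut_edges_iff)
  interpret G: connected_graph "pverts G" "parcs G" by (fact cG)
  define q where "q = G.core_size"
  have q: "n = q + k" "q \<ge> 1" "q \<noteq> 2"
    using G.core_size_eq G.core_size_not_2 nG kG by (auto simp: q_def)
  have K: "?K \<in> graphs_with_cut_edges n k"
    by (rule K_pendant_in_graphs_with_cut_edges) (use q in auto)
  then have pK: "pair_graph ?K" and cK: "connected_graph (pverts ?K) (parcs ?K)"
    and nK: "card (pverts ?K) = n" and kK: "card (finite_graph.bridges (parcs ?K)) = k"
    by (auto simp: graphs_with_cut_edges_iff)
  interpret K: connected_graph "pverts ?K" "parcs ?K" by (fact cK)
  have VK: "pverts ?K = {0..<n}" by (simp add: K_pendant_def)
  have EK: "parcs ?K = clique_star (pverts ?K) {0..<q} 0"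
    using parcs_K_pendant[of k n] q VK by simp
  have QK: "0 \<in> {0..<q}" "{0..<q} \<subseteq> pverts ?K" using q VK by auto
  have qK: "K.core_size = q" and extK: "card (parcs ?K) + q = q\<^sup>2 + 2 * k"
    and degK: "(\<Sum>v\<in>pverts ?K. (K.deg v)\<^sup>2) = star_deg2 q k"
    using K.clique_star_counts[OF EK QK] q kK by simp_all
  note mG = spectral_moments[OF pG] and mK = spectral_moments[OF pK]
  have less4: "i = 0 \<or> i = 1 \<or> i = 2 \<or> i = 3" if "i < 4" for i :: nat
    using that by auto
  show ?thesis
  proof (cases "card (parcs G) + q = q\<^sup>2 + 2 * k")
    case False
    then have less: "card (parcs G) < card (parcs ?K)"
      using G.card_arcs_le extK kG by (simp add: q_def)
    \<comment> \<open>With \<open>q = 1\<close> the maximum is \<open>2 * k\<close> arcs, which the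
      bridges alone provide. So \<open>q \<ge> 3\<close>, and the second moment is within the range
      \<open>n - 1\<close>.\<close>
    have "q \<noteq> 1"
      using less extK G.bridges_subset_arcs kG by auto
    then have "2 \<in> {1..n - 1}" using q by auto
    moreover have "spectral_moment i G = spectral_moment i ?K" if "i < 2" for i
    proof -
      have "i = 0 \<or> i = 1" using that by auto
      then show ?thesis using mG mK nG nK by auto
    qed
    moreover have "spectral_moment 2 G < spectral_moment 2 ?K"
      using less mG mK by simp
    ultimately show ?thesis unfolding S_less_def nG nK by blast
  next
    case True
    then have ext: "card (parcs G) + G.core_size = G.core_size\<^sup>2 + 2 * card G.bridges"
      by (simp add: q_def kG)
    have extK': "card (parcs ?K) + K.core_size = K.core_size\<^sup>2 + 2 * card K.bridges"
      using extK qK kK by simp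
    show ?thesis
    proof (rule G.extremal_dichotomy[OF ext])
      fix Q v
      assume "Q \<subseteq> pverts G" "card Q = G.core_size" "v \<in> Q" "parcs G = clique_star (pverts G) Q v"
      then have "digraph_iso (with_proj G) (with_proj ?K)"
        using clique_star_iso[OF pG refl EK QK K.finV] nG nK by (simp add: q_def)
      then show ?thesis using niso by blast
    next
      assume less: "(\<Sum>v\<in>pverts G. (G.deg v)\<^sup>2) < star_deg2 G.core_size (card G.bridges)"
        and n4: "card (pverts G) = 4 \<Longrightarrow> G.core_size = 1" "4 \<le> card (pverts G)"
      \<comment> \<open>For \<open>n = 4\<close> the dichotomy gives \<open>q = 1\<close>, hence
        \<open>k = 3\<close>, the excluded pair. So \<open>n \<ge> 5\<close>, and the fourth moment
        counts.\<close>
      have "n \<noteq> 4" using n4(1) not43 q(1) by (auto simp: nG q_def)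
      then have n5: "4 \<in> {1..n - 1}" using n4(2) nG by auto
      have arcs: "card (parcs G) = card (parcs ?K)" using True extK by simp
      obtain Q :: "'a set" where Q: "finite Q" "card Q = G.core_size"
        "card G.closed3 = card {xs. length xs = 3 \<and> distinct xs \<and> set xs \<subseteq> Q}"
        "card G.cycles4 = card {xs. length xs = 4 \<and> distinct xs \<and> set xs \<subseteq> Q}"
        by (rule G.extremal_closed_walks[OF ext])
      obtain R :: "nat set" where R: "finite R" "card R = K.core_size"
        "card K.closed3 = card {xs. length xs = 3 \<and> distinct xs \<and> set xs \<subseteq> R}"
        "card K.cycles4 = card {xs. length xs = 4 \<and> distinct xs \<and> set xs \<subseteq> R}"
        by (rule K.extremal_closed_walks[OF extK'])
      have c3: "card G.closed3 = card K.closed3" and c4: "card G.cycles4 = card K.cycles4"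
        by (simp_all only: Q(2-4) R(2-4) card_distinct_lists[OF Q(1)] card_distinct_lists[OF R(1)] qK flip: q_def)
      \<comment> \<open>In \<open>card_closed4\<close> the arcs and the 4-cycles now agree, so the
        squared degrees decide.\<close>
      have "card G.closed4 < card K.closed4"
        using G.card_closed4 K.card_closed4 less degK arcs c4 by (simp add: q_def kG)
      then have "spectral_moment 4 G < spectral_moment 4 ?K" using mG mK by simp
      moreover have "spectral_moment i G = spectral_moment i ?K" if "i < 4" for i
        using less4[OF that] mG mK nG nK arcs c3 by auto
      ultimately show ?thesis using n5 unfolding S_less_def nG nK by blast
    qed
  qed
qed

text \<open>The pair (4, 3) is set apart because the star and the path on four vertices share the
  moments 4, 0, 6, 0 of orders 0 to 3; their fourth moments 18 and 14 lie beyond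
  \<open>n - 1\<close>. Nonemptiness over \<open>nat\<close> speaks for all vertex types, since
  finite graphs can be relabelled by numbers.\<close>

theorem theorem2p1:
  fixes n k :: nat
  assumes "n \<ge> 1"
    and "(graphs_with_cut_edges n k :: nat pair_pre_digraph set) \<noteq> {}"
  shows "K_pendant n k \<in> graphs_with_cut_edges n k \<and>
    ((n, k) \<noteq> (4, 3) \<longrightarrow>
      (\<forall>G :: 'a pair_pre_digraph. G \<in> graphs_with_cut_edges n k \<longrightarrow>
        \<not> digraph_iso (with_proj G) (with_proj (K_pendant n k)) \<longrightarrow> G \<prec>\<^sub>s K_pendant n k))"
proof (intro conjI impI allI)
  obtain G :: "nat pair_pre_digraph" where G: "G \<in> graphs_with_cut_edges n k"
    using assms(2) by blast
  then interpret connected_graph "pverts G" "parcs G"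
    by (simp add: graphs_with_cut_edges_iff)
  have "n = core_size + k" "core_size \<ge> 1"
    using G core_size_eq by (auto simp: graphs_with_cut_edges_iff)
  then show "K_pendant n k \<in> graphs_with_cut_edges n k"
    using core_size_not_2 by (intro K_pendant_in_graphs_with_cut_edges) auto
qed (rule S_less_K_pendant)

end
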